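(* Let $n\ge 2$ and $f\in L^1(\mathbb{R}^n)$. For $\theta\in S_{n-1}$ and $\Im z>0$ set $$F_\theta(z)=\int_0^\infty e^{2i\pi r z}\,\hat f(r\theta)\,r^{n-1}\,dr .$$ Then $$\int_{S_{n-1}}\left(\int_0^\infty\int_{-\infty}^{+\infty}|F_\theta(t+iy)|^2\,y^{n-2}\,dt\,dy\right)d\theta=\frac{1}{(4\pi)^{n-1}}\,\|f\|_{L^2(\mathbb{R}^n)}^2 .$$
   Context: The Fourier transform is $\hat f(\xi)=\int_{\mathbb{R}^n}f(x)e^{-2i\pi x\cdot\xi}\,dx$. $S_{n-1}$ is the unit sphere of $\mathbb{R}^n$ and $d\theta$ its (unnormalized) surface measure.
   Formalization: The constant 1/(4π)^{n-1} is corrected to (n-2)!/(4π)^{n-1}: the printed identity agrees for n = 2, 3 but fails for n ≥ 4, for example for a Gaussian f; the equality is read in [0,∞]. *)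

theory Defs
  imports "HOL-Analysis.Analysis"
begin

definition fourier :: "(real^'n \<Rightarrow> complex) \<Rightarrow> real^'n \<Rightarrow> complex" where
  "fourier f \<xi> = (LINT x|lebesgue. f x * exp (- 2 * \<i> * of_real pi * of_real (x \<bullet> \<xi>)))"

text \<open>Unnormalized surface measure on the unit sphere, as the cone measure: the area of a Borel
  set \<open>A\<close> of unit vectors is \<open>n\<close> times the volume of \<open>{r \<theta>. 0 < r < 1, \<theta> \<in> A}\<close>, so the total
  mass is \<open>n\<close> times the volume of the unit ball. The map \<^const>\<open>sgn\<close> is the radial
  projection \<open>x \<mapsto> x / |x|\<close>.\<close>

definition surface_measure :: "(real^'n) measure" where
  "surface_measure =
     scale_measure (of_nat CARD('n))
       (distr (restrict_space lborel (ball 0 1 - {0})) (restrict_space borel (sphere 0 1)) sgn)"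

definition radial_transform :: "(real^'n \<Rightarrow> complex) \<Rightarrow> real^'n \<Rightarrow> complex \<Rightarrow> complex" where
  "radial_transform f \<theta> z =
     (LINT r:{0<..}|lborel.
        exp (2 * \<i> * of_real pi * of_real r * z) * fourier f (r *\<^sub>R \<theta>) * of_real (r ^ (CARD('n) - 1)))"

end

(* For fixed theta and y, t |-> F_theta(t + iy) is, up to a reflection, the one-dimensional Fourier
   transform of r |-> exp(-2 pi r y) fhat(r theta) r^(n-1) on r > 0. Plancherel in t, the Gamma
   integral in y, polar coordinates and Plancherel in R^n then give the identity.

   Plancherel holds in [0, \<infinity>] for every f in L^1: damping |fhat|^2 by a Gaussian turns its integral
   into the squared L^2 norm of f smoothed by a Gaussian. That norm is at most the norm of f by
   Cauchy-Schwarz, and since the smoothings converge to f in L^1, Fatou's lemma along an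
   almost everywhere convergent subsequence gives the reverse inequality. *)
theory Submission
  imports Defs "HOL-Probability.Characteristic_Functions"
begin

section \<open>Gaussian integrals\<close>

text \<open>Both sides may be infinite, so the identities are stated for nonnegative integrals with
  values in [0, \<infinity>]. The damping step compares two kernels: the damped character and the
  translated Gaussian have the same correlation (the integral of k(z,x) times the conjugate of
  k(z,y) over z), namely a Gaussian of standard deviation \<open>sqrt 2 * t\<close> at
  \<open>x - y\<close>. This match fixes all the constants in the exponents. Plancherel is applied
  in R^n to \<open>f\<close> and in R to a radial profile, so it is proved over an arbitrary
  Euclidean space. The power y^(n-2) is the one for which the Gamma integral divides r^(2(n-1)) by
  r^(n-1) and leaves exactly the polar density r^(n-1). The surface measure is a cone measure, so
  polar coordinates reduce to dilations and Tonelli. Tonelli is run on Borel functions, hence the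
  passage from \<open>f\<close> to a Borel representative.\<close>

lemma lborel_integral_prod_Basis:
  fixes f :: "'a::euclidean_space \<Rightarrow> real \<Rightarrow> 'b::{real_normed_field,banach,second_countable_topology}"
  assumes f: "\<And>b. b \<in> Basis \<Longrightarrow> integrable lborel (f b)"
  shows "(LINT x|lborel. (\<Prod>b\<in>Basis. f b (x \<bullet> b))) = (\<Prod>b\<in>Basis. LINT x|lborel. f b x)"
proof -
  have psf: "product_sigma_finite (\<lambda>b::'a. lborel :: real measure)"
    by (simp add: product_sigma_finite_def sigma_finite_lborel)
  have [measurable]: "\<And>b. b \<in> Basis \<Longrightarrow> f b \<in> borel_measurable borel"
    using f by (auto dest: borel_measurable_integrable)
  have "(LINT x|lborel. (\<Prod>b\<in>Basis. f b (x \<bullet> b)))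
      = (LINT x|Pi\<^sub>M Basis (\<lambda>_. lborel). (\<Prod>b\<in>Basis. f b ((\<Sum>c\<in>Basis. x c *\<^sub>R c) \<bullet> b)))"
    by (subst lborel_eq, subst integral_distr) measurable
  also have "\<dots> = (LINT x|Pi\<^sub>M Basis (\<lambda>_. lborel). (\<Prod>b\<in>Basis. f b (x b)))"
    by (intro Bochner_Integration.integral_cong prod.cong refl) simp
  also have "\<dots> = (\<Prod>b\<in>Basis. LINT x|lborel. f b x)"
    using f by (intro product_sigma_finite.product_integral_prod[OF psf]) auto
  finally show ?thesis .
qed

lemma std_gaussian_fourier:
  "integrable lborel (\<lambda>x. complex_of_real (std_normal_density x) * iexp (t * x))"
  "(CLBINT x. complex_of_real (std_normal_density x) * iexp (t * x)) = of_real (exp (- t\<^sup>2 / 2))"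
proof -
  show "integrable lborel (\<lambda>x. complex_of_real (std_normal_density x) * iexp (t * x))"
  proof (rule Bochner_Integration.integrable_bound)
    show "integrable lborel (std_normal_density)"
      by (rule integrable_normal_density) simp
  qed (auto simp: norm_mult)
  have "(CLBINT x. complex_of_real (std_normal_density x) * iexp (t * x)) = char std_normal_distribution t"
    unfolding char_def
    by (subst integral_density) (auto simp: scaleR_conv_of_real)
  then show "(CLBINT x. complex_of_real (std_normal_density x) * iexp (t * x)) = of_real (exp (- t\<^sup>2 / 2))"
    by (simp add: char_std_normal_distribution)
qed

text \<open>The substitution x -> 2 pi t x turns the weight into exp(-x^2/2) and the frequency into
  -v/t, which is the characteristic function of the standard normal law. The weight is left
  unnormalized so that its transform is a probability density with standard deviation
  \<open>t\<close>.\<close>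

lemma gaussian_fourier_real:
  assumes t: "0 < t"
  shows "integrable lborel (\<lambda>x. complex_of_real (exp (- (2 * pi\<^sup>2 * t\<^sup>2) * x\<^sup>2)) * iexp (- (2 * pi * v * x)))" (is "integrable _ ?f")
    and "(CLBINT x. complex_of_real (exp (- (2 * pi\<^sup>2 * t\<^sup>2) * x\<^sup>2)) * iexp (- (2 * pi * v * x)))
      = of_real (normal_density 0 t v)"
proof -
  let ?g = "\<lambda>x. complex_of_real (std_normal_density x) * iexp (- (v / t) * x)"
  have fg: "?f x = of_real (sqrt (2 * pi)) * ?g (0 + 2 * pi * t * x)" for x
    using t by (simp add: std_normal_density_def power2_eq_square field_simps)
  have "integrable lborel (\<lambda>x. ?g (0 + 2 * pi * t * x))"
    using t by (intro lborel_integrable_real_affine std_gaussian_fourier) simp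
  then show "integrable lborel ?f"
    unfolding fg by (rule integrable_mult_right)
  define J where "J = (LBINT x. ?g (0 + 2 * pi * t * x))"
  have "(LBINT x. ?g x) = 2 * pi * t * J"
    using t unfolding J_def
    by (subst lborel_integral_real_affine[where c="2 * pi * t" and t=0])
       (simp_all add: scaleR_conv_of_real abs_mult)
  moreover have "(LBINT x. ?g x) = of_real (exp (- (v / t)\<^sup>2 / 2))"
    using std_gaussian_fourier(2)[of "- (v / t)"] by simp
  ultimately have "J = of_real (exp (- (v / t)\<^sup>2 / 2) / (2 * pi * t))"
    using t by (simp add: field_simps)
  then have "(LBINT x. ?g (0 + 2 * pi * t * x)) = of_real (exp (- (v / t)\<^sup>2 / 2) / (2 * pi * t))"
    unfolding J_def .
  then have "(LBINT x. ?f x) = of_real (sqrt (2 * pi)) * of_real (exp (- (v / t)\<^sup>2 / 2) / (2 * pi * t))"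
    unfolding fg by simp
  also have "\<dots> = of_real (normal_density 0 t v)"
    using t unfolding of_real_mult[symmetric] normal_density_def
    by (intro arg_cong[of _ _ of_real]) (simp add: real_sqrt_mult power_divide field_simps)
  finally show "(LBINT x. ?f x) = of_real (normal_density 0 t v)" .
qed

text \<open>The centered normal density with covariance t^2 times the identity; \<open>t\<close> is
  the standard deviation. The product over \<open>Basis\<close> lets every integral factor into
  one-dimensional ones.\<close>

definition gaussian :: "real \<Rightarrow> 'a::euclidean_space \<Rightarrow> real" where
  "gaussian t u = (\<Prod>b\<in>Basis. normal_density 0 t (u \<bullet> b))"

lemma gaussian_nonneg [simp]: "0 \<le> gaussian t u"
  by (simp add: gaussian_def prod_nonneg)

lemma borel_measurable_gaussian [measurable]: "gaussian t \<in> borel_measurable borel"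
  unfolding gaussian_def[abs_def] by measurable

lemma nn_integral_gaussian:
  assumes "0 < t"
  shows "(\<integral>\<^sup>+u. ennreal (gaussian t u) \<partial>lborel) = 1"
proof -
  have "(\<integral>\<^sup>+x. ennreal (normal_density 0 t x) \<partial>lborel) = 1"
    using assms by (subst nn_integral_eq_integral) auto
  then show ?thesis
    unfolding gaussian_def
    by (subst prod_ennreal[symmetric])
       (simp_all add: nn_integral_lborel_prod[of "\<lambda>_ x. ennreal (normal_density 0 t x)"])
qed

lemma gaussian_bounded:
  assumes "0 < t"
  obtains C where "\<And>u::'a::euclidean_space. gaussian t u \<le> C"
proof
  fix u :: 'a
  show "gaussian t u \<le> (\<Prod>b\<in>(Basis::'a set). 1 / sqrt (2 * pi * t\<^sup>2))"
    unfolding gaussian_def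
    by (intro prod_mono) (auto simp: normal_density_def divide_right_mono)
qed

lemma gaussian_scaleR:
  assumes "0 < t"
  shows "gaussian t (t *\<^sub>R u) * t ^ DIM('a) = gaussian 1 (u::'a::euclidean_space)"
proof -
  have "normal_density 0 t (t * x) * t = normal_density 0 1 x" for x
    using assms by (simp add: normal_density_def power_mult_distrib real_sqrt_mult)
  then show ?thesis
    unfolding gaussian_def by (simp add: prod.distrib[symmetric] flip: prod_constant)
qed

text \<open>In each coordinate two reflections compose to the shift z -> z + b, and since the
  density is even this gives the convolution of two centered normal densities. Variances add, t^2 +
  t^2, hence the standard deviation \<open>sqrt 2 * t\<close>.\<close>

lemma gaussian_conv:
  fixes x y :: "'a::euclidean_space"
  assumes t: "0 < t"
  shows "(\<integral>\<^sup>+z. ennreal (gaussian t (x - z) * gaussian t (y - z)) \<partial>lborel)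
    = ennreal (gaussian (sqrt 2 * t) (x - y))"
proof -
  have *: "(\<integral>\<^sup>+z. ennreal (normal_density 0 t (a - z) * normal_density 0 t (b - z)) \<partial>lborel)
    = ennreal (normal_density 0 (sqrt 2 * t) (a - b))" for a b
  proof -
    have "(\<integral>\<^sup>+z. ennreal (normal_density 0 t (a - z) * normal_density 0 t (b - z)) \<partial>lborel)
      = (\<integral>\<^sup>+z. ennreal (normal_density 0 t (a - (b + -1 * z)) * normal_density 0 t (b - (b + -1 * z))) \<partial>lborel)"
      by (subst nn_integral_real_affine[where c="-1" and t=b]) auto
    also have "\<dots> = (\<integral>\<^sup>+z. ennreal (normal_density 0 t ((a - b) - (0 + -1 * z)) * normal_density 0 t (0 + -1 * z)) \<partial>lborel)"
      by (simp add: algebra_simps normal_density_def)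
    also have "\<dots> = (\<integral>\<^sup>+z. ennreal (normal_density 0 t ((a - b) - z) * normal_density 0 t z) \<partial>lborel)"
      by (subst (2) nn_integral_real_affine[where c="-1" and t=0]) auto
    also have "\<dots> = ennreal (normal_density 0 (sqrt (t\<^sup>2 + t\<^sup>2)) (a - b))"
      using fun_cong[OF conv_normal_density_zero_mean[OF t t], of "a - b"] by simp
    also have "sqrt (t\<^sup>2 + t\<^sup>2) = sqrt 2 * t"
      using t by (simp add: real_sqrt_mult flip: mult_2)
    finally show ?thesis .
  qed
  have "(\<integral>\<^sup>+z. ennreal (gaussian t (x - z) * gaussian t (y - z)) \<partial>lborel)
      = (\<integral>\<^sup>+z. (\<Prod>b\<in>Basis. ennreal (normal_density 0 t (x \<bullet> b - z \<bullet> b) * normal_density 0 t (y \<bullet> b - z \<bullet> b))) \<partial>lborel)"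
    unfolding gaussian_def by (simp add: prod_ennreal prod.distrib inner_diff_left)
  also have "\<dots> = ennreal (gaussian (sqrt 2 * t) (x - y))"
    by (subst nn_integral_lborel_prod) (simp_all add: * gaussian_def prod_ennreal inner_diff_left)
  finally show ?thesis .
qed

lemma gaussian_fourier:
  fixes v :: "'a::euclidean_space"
  assumes t: "0 < t"
  shows "(CLINT \<xi>|lborel. of_real (exp (- (2 * pi\<^sup>2 * t\<^sup>2) * (\<xi> \<bullet> \<xi>))) * iexp (- (2 * pi * (v \<bullet> \<xi>))))
    = of_real (gaussian t v)"
proof -
  let ?f = "\<lambda>b x. complex_of_real (exp (- (2 * pi\<^sup>2 * t\<^sup>2) * x\<^sup>2)) * iexp (- (2 * pi * (v \<bullet> b) * x))"
  have "(\<Prod>b\<in>Basis. ?f b (\<xi> \<bullet> b))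
      = of_real (exp (- (2 * pi\<^sup>2 * t\<^sup>2) * (\<xi> \<bullet> \<xi>))) * iexp (- (2 * pi * (v \<bullet> \<xi>)))" for \<xi>
    unfolding euclidean_inner[of \<xi> \<xi>] euclidean_inner[of v \<xi>]
    by (simp add: prod.distrib exp_sum[symmetric] sum_distrib_left power2_eq_square sum_negf mult.assoc flip: of_real_prod)
  then have "(CLINT \<xi>|lborel. of_real (exp (- (2 * pi\<^sup>2 * t\<^sup>2) * (\<xi> \<bullet> \<xi>))) * iexp (- (2 * pi * (v \<bullet> \<xi>))))
    = (CLINT \<xi>|lborel. (\<Prod>b\<in>Basis. ?f b (\<xi> \<bullet> b)))"
    by simp
  also have "\<dots> = (\<Prod>b\<in>Basis. LBINT x. ?f b x)"
    using t by (intro lborel_integral_prod_Basis gaussian_fourier_real)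
  also have "\<dots> = of_real (gaussian t v)"
    by (simp only: gaussian_fourier_real(2)[OF t] gaussian_def of_real_prod)
  finally show ?thesis .
qed

text \<open>A function that is not integrable has Bochner integral 0 by convention, whereas
  \<open>gaussian_fourier\<close> at v = 0 gives the positive value
  \<open>gaussian t 0\<close>.\<close>

lemma integrable_gaussian_weight:
  assumes t: "0 < t"
  shows "integrable lborel (\<lambda>\<xi>::'a::euclidean_space. exp (- (2 * pi\<^sup>2 * t\<^sup>2) * (\<xi> \<bullet> \<xi>)))"
proof (rule ccontr)
  assume "\<not> ?thesis"
  then have "(LINT \<xi>|lborel. exp (- (2 * pi\<^sup>2 * t\<^sup>2) * (\<xi> \<bullet> (\<xi>::'a)))) = 0"
    by (rule not_integrable_integral_eq)
  then have "gaussian t (0::'a) = 0"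
    using gaussian_fourier[OF t, of "0::'a"] by (simp add: integral_of_real)
  then show False
    using t by (simp add: gaussian_def normal_density_def)
qed

section \<open>Translation in the mean\<close>

lemma
  fixes f :: "'a::euclidean_space \<Rightarrow> 'b::{banach,second_countable_topology}"
  assumes f: "integrable lborel f"
  shows integrable_lborel_translate: "integrable lborel (\<lambda>x. f (x + h))"
    and integral_lborel_translate: "(LINT x|lborel. f (x + h)) = (LINT x|lborel. f x)"
proof -
  have [measurable]: "f \<in> borel_measurable borel"
    using f by (auto dest: borel_measurable_integrable)
  have "integrable (distr lborel borel ((+) h)) f"
    using f by (simp add: lborel_distr_plus)
  then show "integrable lborel (\<lambda>x. f (x + h))"
    by (simp add: integrable_distr_eq add.commute)
  have "(LINT x|lborel. f x) = (LINT x|distr lborel borel ((+) h). f x)"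
    by (simp add: lborel_distr_plus)
  then show "(LINT x|lborel. f (x + h)) = (LINT x|lborel. f x)"
    by (simp add: integral_distr add.commute)
qed

lemma nn_integral_lborel_translate:
  fixes f :: "'a::euclidean_space \<Rightarrow> ennreal"
  assumes [measurable]: "f \<in> borel_measurable borel"
  shows "(\<integral>\<^sup>+x. f (x + h) \<partial>lborel) = (\<integral>\<^sup>+x. f x \<partial>lborel)"
proof -
  have "(\<integral>\<^sup>+x. f x \<partial>lborel) = (\<integral>\<^sup>+x. f x \<partial>distr lborel borel ((+) h))"
    by (simp add: lborel_distr_plus)
  then show ?thesis
    by (simp add: nn_integral_distr add.commute)
qed

lemma nn_integral_lborel_scaleR:
  fixes f :: "'a::euclidean_space \<Rightarrow> ennreal"
  assumes [measurable]: "f \<in> borel_measurable borel" and "c \<noteq> 0"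
  shows "(\<integral>\<^sup>+x. f x \<partial>lborel) = ennreal (\<bar>c\<bar> ^ DIM('a)) * (\<integral>\<^sup>+x. f (c *\<^sub>R x) \<partial>lborel)"
  by (subst lborel_affine[OF \<open>c \<noteq> 0\<close>, of 0])
     (simp add: nn_integral_density nn_integral_distr nn_integral_cmult)

text \<open>A three-term estimate: by translation invariance f(x + h) - g(x + h) has the same L^1
  norm as f - g, so closeness of f to g is paid for twice. With e/4 everywhere the total stays
  strictly below e.\<close>

lemma tendsto_translate_L1_approx:
  fixes f :: "'a::euclidean_space \<Rightarrow> 'b::{banach,second_countable_topology}"
  assumes f: "integrable lborel f"
    and approx: "\<And>e. 0 < e \<Longrightarrow> \<exists>g. integrable lborel g \<and> (LINT x|lborel. norm (f x - g x)) \<le> e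
        \<and> (\<lambda>k. LINT x|lborel. norm (g (x + h k) - g x)) \<longlonglongrightarrow> 0"
  shows "(\<lambda>k. LINT x|lborel. norm (f (x + h k) - f x)) \<longlonglongrightarrow> 0"
proof (rule LIMSEQ_I)
  fix e :: real assume "0 < e"
  then obtain g where g: "integrable lborel g" "(LINT x|lborel. norm (f x - g x)) \<le> e / 4"
      "(\<lambda>k. LINT x|lborel. norm (g (x + h k) - g x)) \<longlonglongrightarrow> 0"
    using approx[of "e / 4"] by auto
  have le: "(LINT x|lborel. norm (f (x + h k) - f x))
    \<le> 2 * (LINT x|lborel. norm (f x - g x)) + (LINT x|lborel. norm (g (x + h k) - g x))" for k
  proof -
    note [simp] = integrable_lborel_translate f g(1)
    have fg: "integrable lborel (\<lambda>x. norm (f x - g x))"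
      by simp
    have "(LINT x|lborel. norm (f (x + h k) - f x))
      \<le> (LINT x|lborel. norm (f (x + h k) - g (x + h k)) + norm (f x - g x) + norm (g (x + h k) - g x))"
    proof (rule integral_mono)
      fix x
      have "f (x + h k) - f x = (f (x + h k) - g (x + h k)) + (g x - f x) + (g (x + h k) - g x)"
        by simp
      then show "norm (f (x + h k) - f x)
          \<le> norm (f (x + h k) - g (x + h k)) + norm (f x - g x) + norm (g (x + h k) - g x)"
        by (metis add_mono norm_minus_commute norm_triangle_le order_refl)
    qed simp_all
    also have "\<dots> = 2 * (LINT x|lborel. norm (f x - g x)) + (LINT x|lborel. norm (g (x + h k) - g x))"
      using integral_lborel_translate[OF fg, of "h k"] by simp
    finally show ?thesis .
  qed
  obtain N where N: "\<And>k. N \<le> k \<Longrightarrow> \<bar>LINT x|lborel. norm (g (x + h k) - g x)\<bar> < e / 4"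
    using LIMSEQ_D[OF g(3), of "e / 4"] \<open>0 < e\<close> by auto
  have "\<bar>LINT x|lborel. norm (f (x + h k) - f x)\<bar> < e" if "N \<le> k" for k
    using le[of k] N[OF that] g(2) \<open>0 < e\<close>
    by (subst abs_of_nonneg) (auto intro!: integral_nonneg)
  then show "\<exists>N. \<forall>k\<ge>N. norm ((LINT x|lborel. norm (f (x + h k) - f x)) - 0) < e"
    by auto
qed

text \<open>Openness gives pointwise convergence only on \<open>U\<close>: a point of
  \<open>U\<close> stays in \<open>U\<close> after a small shift, while a boundary point outside
  \<open>U\<close> may be moved in for infinitely many k. So dominated convergence, with majorant
  \<open>indicator U\<close>, is applied only to the half \<open>?d\<close> of the symmetric
  difference that lies in \<open>U\<close>.\<close>

lemma tendsto_translate_L1_open: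
  fixes c :: "'b::{banach,second_countable_topology}" and U :: "'a::euclidean_space set"
  assumes h: "h \<longlonglongrightarrow> 0" and U: "open U" "emeasure lborel U < \<infinity>"
  shows "(\<lambda>k. LINT x|lborel. norm (indicator U (x + h k) *\<^sub>R c - indicator U x *\<^sub>R c)) \<longlonglongrightarrow> 0"
proof -
  let ?d = "\<lambda>k x. indicator U x * (1 - indicator U (x + h k)) :: real"
  have [measurable]: "U \<in> sets borel"
    using U by simp
  have iU: "integrable lborel (indicator U :: 'a \<Rightarrow> real)"
    using U by (simp add: integrable_indicator_iff)
  have id: "integrable lborel (?d k)" for k
    by (rule Bochner_Integration.integrable_bound[OF iU]) (auto split: split_indicator)
  have "(\<lambda>k. LINT x|lborel. ?d k x) \<longlonglongrightarrow> (LINT x|(lborel :: 'a measure). (0::real))"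
  proof (rule integral_dominated_convergence[where w="indicator U"])
    show "AE x in lborel. (\<lambda>k. ?d k x) \<longlonglongrightarrow> 0"
    proof (rule AE_I2)
      fix x :: 'a
      show "(\<lambda>k. ?d k x) \<longlonglongrightarrow> 0"
      proof (cases "x \<in> U")
        case True
        have "(\<lambda>k. x + h k) \<longlonglongrightarrow> x + 0"
          by (intro tendsto_intros h)
        then have "\<forall>\<^sub>F k in sequentially. x + h k \<in> U"
          using U(1) True by (simp add: topological_tendstoD)
        then have "\<forall>\<^sub>F k in sequentially. ?d k x = 0"
          by eventually_elim simp
        then show ?thesis
          by (rule tendsto_eventually)
      qed simp
    qed
  qed (use iU in \<open>auto split: split_indicator\<close>)
  then have lim: "(\<lambda>k. 2 * norm c * (LINT x|lborel. ?d k x)) \<longlonglongrightarrow> 0"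
    by (auto intro!: tendsto_mult_right_zero)
  \<comment> \<open>\<open>U\<close> and its translate have the same volume, so the two halves of their symmetric difference do too.\<close>
  have "(LINT x|lborel. norm (indicator U (x + h k) *\<^sub>R c - indicator U x *\<^sub>R c))
     = 2 * norm c * (LINT x|lborel. ?d k x)" for k
  proof -
    note iUh = integrable_lborel_translate[OF iU, of "h k"]
    have "(LINT x|lborel. norm (indicator U (x + h k) *\<^sub>R c - indicator U x *\<^sub>R c))
       = (LINT x|lborel. norm c * (indicator U (x + h k) - indicator U x + 2 * ?d k x))"
      by (intro Bochner_Integration.integral_cong) (auto split: split_indicator)
    also have "\<dots> = norm c * ((LINT x|lborel. indicator U (x + h k)) - (LINT x|lborel. indicator U x)
        + 2 * (LINT x|lborel. ?d k x))"
      using iU id[of k] iUh by simp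
    also have "\<dots> = 2 * norm c * (LINT x|lborel. ?d k x)"
      using integral_lborel_translate[OF iU, of "h k"] by simp
    finally show ?thesis .
  qed
  with lim show ?thesis
    by simp
qed

text \<open>Induction over integrable functions. An indicator of finite measure is approximated in
  L^1 by that of an open superset through outer regularity, and a limit by the functions converging
  to it; both cases end in \<open>tendsto_translate_L1_approx\<close>.\<close>

lemma tendsto_translate_L1:
  fixes f :: "'a::euclidean_space \<Rightarrow> 'b::{banach,second_countable_topology}"
  assumes "integrable lborel f" and h: "h \<longlonglongrightarrow> 0"
  shows "(\<lambda>k. LINT x|lborel. norm (f (x + h k) - f x)) \<longlonglongrightarrow> 0"
  using assms(1)
proof induction
  case (base A c)
  then have [measurable]: "A \<in> sets borel"
    by simp
  show ?case
  proof (rule tendsto_translate_L1_approx)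
    show "integrable lborel (\<lambda>x. indicator A x *\<^sub>R c)"
      using base by (intro integrable_scaleR_left) (simp add: integrable_indicator_iff)
    fix e :: real assume "0 < e"
    \<comment> \<open>The error is \<open>norm c * d\<close>, to be at most \<open>e\<close>; the
      added 1 keeps the quotient defined when c = 0.\<close>
    define d where "d = e / (norm c + 1)"
    have "0 < d"
      using \<open>0 < e\<close> by (simp add: d_def add_nonneg_pos)
    then obtain U where U: "open U" "A \<subseteq> U" "emeasure lborel (U - A) < d"
      using outer_regular_lborel[of A d] by auto
    have [measurable]: "U \<in> sets borel"
      using U by simp
    have "emeasure lborel U = emeasure lborel A + emeasure lborel (U - A)"
      using U by (subst plus_emeasure) (auto intro!: arg_cong2[where f=emeasure])
    also have "\<dots> < \<infinity>"
      using base U(3) by (auto simp: less_top[symmetric] ennreal_add_eq_top)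
    finally have fin: "emeasure lborel U < \<infinity>" .
    have meas: "measure lborel (U - A) \<le> d"
      using U(3) \<open>0 < d\<close> by (simp add: measure_def enn2real_leI less_imp_le)
    have "(LINT x|lborel. norm (indicator A x *\<^sub>R c - indicator U x *\<^sub>R c))
       = (LINT x|lborel. norm c * indicator (U - A) x)"
      using U(2) by (intro Bochner_Integration.integral_cong) (auto split: split_indicator)
    also have "\<dots> \<le> norm c * d"
      using meas by (simp add: mult_left_mono)
    also have "\<dots> \<le> e"
      using \<open>0 < e\<close> add_nonneg_pos[OF norm_ge_zero zero_less_one, of c]
      by (simp add: d_def pos_divide_le_eq mult.commute)
    finally show "\<exists>g. integrable lborel g \<and> (LINT x|lborel. norm (indicator A x *\<^sub>R c - g x)) \<le> e
        \<and> (\<lambda>k. LINT x|lborel. norm (g (x + h k) - g x)) \<longlonglongrightarrow> 0"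
      using tendsto_translate_L1_open[OF h U(1) fin, of c] fin
      by (intro exI[of _ "\<lambda>x. indicator U x *\<^sub>R c"]) (auto intro!: integrable_scaleR_left simp: integrable_indicator_iff)
  qed
next
  case (add f g)
  note [simp] = integrable_lborel_translate add.hyps
  show ?case
  proof (rule tendsto_sandwich[OF _ _ tendsto_const])
    show "(\<lambda>k. (LINT x|lborel. norm (f (x + h k) - f x)) + (LINT x|lborel. norm (g (x + h k) - g x))) \<longlonglongrightarrow> 0"
      using tendsto_add[OF add.IH] by simp
    have "(LINT x|lborel. norm (f (x + h k) + g (x + h k) - (f x + g x)))
        \<le> (LINT x|lborel. norm (f (x + h k) - f x) + norm (g (x + h k) - g x))" for k
      by (intro integral_mono norm_diff_triangle_ineq) simp_all
    then show "\<forall>\<^sub>F k in sequentially. (LINT x|lborel. norm (f (x + h k) + g (x + h k) - (f x + g x)))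
        \<le> (LINT x|lborel. norm (f (x + h k) - f x)) + (LINT x|lborel. norm (g (x + h k) - g x))"
      by (simp add: always_eventually)
  qed (auto intro!: always_eventually integral_nonneg)
next
  case (lim f s)
  show ?case
  proof (rule tendsto_translate_L1_approx[OF lim(4)])
    fix e :: real assume "0 < e"
    have [measurable]: "f \<in> borel_measurable borel" "\<And>i. s i \<in> borel_measurable borel"
      using lim(4) lim(1) by (auto dest: borel_measurable_integrable)
    have "(\<lambda>i. LINT x|lborel. norm (f x - s i x)) \<longlonglongrightarrow> (LINT x|(lborel :: 'a measure). (0::real))"
    \<comment> \<open>The induction rule provides the bound 2 * norm (f x) for norm (s i x), and the
      triangle inequality adds one more norm (f x).\<close>
    proof (rule integral_dominated_convergence[where w="\<lambda>x. 3 * norm (f x)"])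
      show "AE x in lborel. (\<lambda>i. norm (f x - s i x)) \<longlonglongrightarrow> 0"
      proof (rule AE_I2)
        fix x :: 'a
        have "(\<lambda>i. norm (f x - s i x)) \<longlonglongrightarrow> norm (f x - f x)"
          by (intro tendsto_intros lim) simp
        then show "(\<lambda>i. norm (f x - s i x)) \<longlonglongrightarrow> 0"
          by simp
      qed
      show "AE x in lborel. norm (norm (f x - s i x)) \<le> 3 * norm (f x)" for i
      proof (rule AE_I2)
        fix x :: 'a
        show "norm (norm (f x - s i x)) \<le> 3 * norm (f x)"
          using norm_triangle_ineq4[of "f x" "s i x"] lim(3)[of x i] by simp
      qed
    qed (use lim(4) in auto)
    then obtain i where "(LINT x|lborel. norm (f x - s i x)) < e"
      using LIMSEQ_D[of _ 0 e] \<open>0 < e\<close> by fastforce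
    then show "\<exists>g. integrable lborel g \<and> (LINT x|lborel. norm (f x - g x)) \<le> e
        \<and> (\<lambda>k. LINT x|lborel. norm (g (x + h k) - g x)) \<longlonglongrightarrow> 0"
      using lim by (intro exI[of _ "s i"]) auto
  qed
qed

section \<open>Smoothing by Gaussians\<close>

lemma borel_measurable_cnj [measurable]: "cnj \<in> borel_measurable borel"
  by (intro borel_measurable_continuous_onI continuous_intros)

lemma
  fixes u :: "'a::euclidean_space \<Rightarrow> complex"
  assumes u: "integrable lborel u"
  shows integrable_mult_cnj_pair: "integrable (lborel \<Otimes>\<^sub>M lborel) (\<lambda>p. u (fst p) * cnj (u (snd p)))"
    and integral_mult_cnj_pair: "(LINT p|(lborel \<Otimes>\<^sub>M lborel). u (fst p) * cnj (u (snd p)))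
      = of_real ((norm (LINT x|lborel. u x))\<^sup>2)"
proof -
  have [measurable]: "u \<in> borel_measurable borel"
    using u by (auto dest: borel_measurable_integrable)
  show int: "integrable (lborel \<Otimes>\<^sub>M lborel) (\<lambda>p. u (fst p) * cnj (u (snd p)))"
  proof (rule lborel_pair.Fubini_integrable)
    show "integrable lborel (\<lambda>x. LINT y|lborel. norm (u (fst (x, y)) * cnj (u (snd (x, y)))))"
      using u by (simp add: norm_mult)
    show "AE x in lborel. integrable lborel (\<lambda>y. u (fst (x, y)) * cnj (u (snd (x, y))))"
      using u by simp
  qed measurable
  have "(LINT p|(lborel \<Otimes>\<^sub>M lborel). u (fst p) * cnj (u (snd p)))
      = (LINT x|lborel. LINT y|lborel. u x * cnj (u y))"
    using lborel_pair.integral_fst'[OF int] by simp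
  also have "\<dots> = (LINT x|lborel. u x) * cnj (LINT x|lborel. u x)"
    by simp
  finally show "(LINT p|(lborel \<Otimes>\<^sub>M lborel). u (fst p) * cnj (u (snd p)))
      = of_real ((norm (LINT x|lborel. u x))\<^sup>2)"
    by (simp only: complex_norm_square)
qed

text \<open>The squared modulus is written as a double integral over (x, y) and the z-integral is
  moved inside by Fubini. \<open>B\<close> makes each single integral converge; \<open>C\<close>,
  together with integrability of f(x) cnj(f(y)), makes the triple integral converge absolutely. The
  right side depends on the kernel only through its correlation, so two kernels with equal
  correlations give equal L^2 norms, even if their variable z plays quite different roles.\<close>

lemma nn_integral_kernel_square:
  fixes f :: "'a::euclidean_space \<Rightarrow> complex" and k :: "'b::euclidean_space \<Rightarrow> 'a \<Rightarrow> complex"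
  assumes f: "integrable lborel f"
    and k [measurable]: "(\<lambda>(z, x). k z x) \<in> borel_measurable (borel \<Otimes>\<^sub>M borel)"
    and B: "\<And>z x. norm (k z x) \<le> B"
    and C: "\<And>x y. (\<integral>\<^sup>+z. ennreal (norm (k z x) * norm (k z y)) \<partial>lborel) \<le> ennreal C"
  shows "(\<integral>\<^sup>+z. ennreal ((norm (LINT x|lborel. f x * k z x))\<^sup>2) \<partial>lborel)
    = ennreal (Re (LINT p|(lborel \<Otimes>\<^sub>M lborel). f (fst p) * cnj (f (snd p))
        * (LINT z|lborel. k z (fst p) * cnj (k z (snd p)))))"
proof -
  define F where "F p = f (fst p) * cnj (f (snd p))" for p
  define K where "K p z = k z (fst p) * cnj (k z (snd p))" for p z
  have [measurable]: "f \<in> borel_measurable borel"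
    using f by (auto dest: borel_measurable_integrable)
  have F_meas [measurable]: "F \<in> borel_measurable (lborel \<Otimes>\<^sub>M lborel)"
    unfolding F_def[abs_def] by measurable
  have K_meas [measurable]: "(\<lambda>(p, z). K p z) \<in> borel_measurable ((lborel \<Otimes>\<^sub>M lborel) \<Otimes>\<^sub>M lborel)"
    unfolding K_def[abs_def] by measurable
  have Kp_meas [measurable]: "K p \<in> borel_measurable borel" for p
    unfolding K_def[abs_def] by measurable
  have psf: "pair_sigma_finite (lborel \<Otimes>\<^sub>M lborel :: ('a \<times> 'a) measure) (lborel :: 'b measure)"
    by (simp add: lborel_prod pair_sigma_finite_def sigma_finite_lborel)
  have F_int: "integrable (lborel \<Otimes>\<^sub>M lborel) F"
    unfolding F_def[abs_def] by (rule integrable_mult_cnj_pair[OF f])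
  have FK_int: "integrable ((lborel \<Otimes>\<^sub>M lborel) \<Otimes>\<^sub>M lborel) (\<lambda>(p, z). F p * K p z)"
  proof (rule integrableI_bounded)
    have "(\<integral>\<^sup>+q. norm (case q of (p, z) \<Rightarrow> F p * K p z) \<partial>((lborel \<Otimes>\<^sub>M lborel) \<Otimes>\<^sub>M lborel))
        = (\<integral>\<^sup>+p. (\<integral>\<^sup>+z. ennreal (norm (F p * K p z)) \<partial>lborel) \<partial>(lborel \<Otimes>\<^sub>M lborel))"
      by (subst lborel.nn_integral_fst[symmetric]) auto
    also have "\<dots> = (\<integral>\<^sup>+p. ennreal (norm (F p)) * (\<integral>\<^sup>+z. ennreal (norm (K p z)) \<partial>lborel) \<partial>(lborel \<Otimes>\<^sub>M lborel))"
      by (simp add: norm_mult ennreal_mult nn_integral_cmult)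
    also have "\<dots> \<le> (\<integral>\<^sup>+p. ennreal (norm (F p)) * ennreal C \<partial>(lborel \<Otimes>\<^sub>M lborel))"
      using C by (intro nn_integral_mono mult_left_mono) (auto simp: K_def norm_mult)
    also have "\<dots> < \<infinity>"
      using F_int by (simp add: nn_integral_multc integrable_iff_bounded ennreal_mult_less_top)
    finally show "(\<integral>\<^sup>+q. norm (case q of (p, z) \<Rightarrow> F p * K p z) \<partial>((lborel \<Otimes>\<^sub>M lborel) \<Otimes>\<^sub>M lborel)) < \<infinity>" .
  qed measurable
  have fk: "integrable lborel (\<lambda>x. f x * k z x)" for z
  proof (rule Bochner_Integration.integrable_bound)
    show "integrable lborel (\<lambda>x. B * norm (f x))"
      using f by simp
    show "AE x in lborel. norm (f x * k z x) \<le> norm (B * norm (f x))"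
    proof (rule AE_I2)
      fix x
      have "norm (f x * k z x) \<le> norm (f x) * B"
        using B by (simp add: norm_mult mult_left_mono)
      also have "\<dots> \<le> norm (B * norm (f x))"
        by (simp add: mult.commute)
      finally show "norm (f x * k z x) \<le> norm (B * norm (f x))" .
    qed
  qed measurable
  have sq: "complex_of_real ((norm (LINT x|lborel. f x * k z x))\<^sup>2) = (LINT p|(lborel \<Otimes>\<^sub>M lborel). F p * K p z)" for z
    unfolding integral_mult_cnj_pair[OF fk, symmetric] by (simp add: F_def K_def mult_ac)
  have "integrable lborel (\<lambda>z. LINT p|(lborel \<Otimes>\<^sub>M lborel). F p * K p z)"
    by (rule pair_sigma_finite.integrable_snd[OF psf FK_int])
  then have "integrable lborel (\<lambda>z. complex_of_real ((norm (LINT x|lborel. f x * k z x))\<^sup>2))"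
    by (subst sq)
  then have int: "integrable lborel (\<lambda>z. (norm (LINT x|lborel. f x * k z x))\<^sup>2)"
    by (rule complex_of_real_integrable_eq[THEN iffD1])
  have "complex_of_real (LINT z|lborel. (norm (LINT x|lborel. f x * k z x))\<^sup>2)
      = (LINT z|lborel. LINT p|(lborel \<Otimes>\<^sub>M lborel). F p * K p z)"
    unfolding sq[symmetric] by (rule integral_of_real[OF int, symmetric])
  also have "\<dots> = (LINT p|(lborel \<Otimes>\<^sub>M lborel). LINT z|lborel. F p * K p z)"
    by (rule pair_sigma_finite.Fubini_integral[OF psf FK_int])
  also have "\<dots> = (LINT p|(lborel \<Otimes>\<^sub>M lborel). F p * (LINT z|lborel. K p z))"
    by simp
  finally have "Re (complex_of_real (LINT z|lborel. (norm (LINT x|lborel. f x * k z x))\<^sup>2))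
      = Re (LINT p|(lborel \<Otimes>\<^sub>M lborel). F p * (LINT z|lborel. K p z))"
    by (rule arg_cong)
  then have "(LINT z|lborel. (norm (LINT x|lborel. f x * k z x))\<^sup>2)
      = Re (LINT p|(lborel \<Otimes>\<^sub>M lborel). F p * (LINT z|lborel. K p z))"
    by (simp only: Re_complex_of_real)
  then show ?thesis
    using int by (simp add: nn_integral_eq_integral F_def K_def)
qed

text \<open>The counterpart of \<open>fourier\<close> for Borel functions on any Euclidean space, so
  that it also serves on the real line for the radial variable.\<close>

definition fourier_transform :: "('a::euclidean_space \<Rightarrow> complex) \<Rightarrow> 'a \<Rightarrow> complex" where
  "fourier_transform f \<xi> = (LINT x|lborel. f x * exp (- 2 * \<i> * of_real pi * of_real (x \<bullet> \<xi>)))"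

text \<open>Convolution with the Gaussian: the kernel is even, so \<open>x - z\<close> may stand for
  \<open>z - x\<close>.\<close>

definition gaussian_smooth :: "real \<Rightarrow> ('a::euclidean_space \<Rightarrow> complex) \<Rightarrow> 'a \<Rightarrow> complex" where
  "gaussian_smooth t f z = (LINT x|lborel. f x * of_real (gaussian t (x - z)))"

lemma borel_measurable_gaussian_smooth [measurable]:
  assumes [measurable]: "f \<in> borel_measurable borel"
  shows "gaussian_smooth t f \<in> borel_measurable borel"
  unfolding gaussian_smooth_def[abs_def] by measurable

lemma nn_integral_gaussian_translate:
  assumes "0 < t"
  shows "(\<integral>\<^sup>+x. ennreal (gaussian t (x - z)) \<partial>lborel) = 1"
  using nn_integral_lborel_translate[of "\<lambda>x. ennreal (gaussian t x)" "- z"] nn_integral_gaussian[OF assms]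
  by simp

text \<open>The kernel has mass 1 both in x and in z. Mass 1 in x turns Cauchy-Schwarz into a
  pointwise bound of the squared smoothing by the smoothing of |f|^2; mass 1 in z then removes the
  kernel after Tonelli.\<close>

lemma gaussian_smooth_l2_le:
  assumes [measurable]: "f \<in> borel_measurable borel" and t: "0 < t"
  shows "(\<integral>\<^sup>+z. ennreal ((norm (gaussian_smooth t f z))\<^sup>2) \<partial>lborel) \<le> (\<integral>\<^sup>+x. ennreal ((norm (f x))\<^sup>2) \<partial>lborel)"
proof -
  have "ennreal ((norm (gaussian_smooth t f z))\<^sup>2)
      \<le> (\<integral>\<^sup>+x. ennreal ((norm (f x))\<^sup>2) * ennreal (gaussian t (x - z)) \<partial>lborel)" for z
  proof -
    \<comment> \<open>The kernel is split into two equal square roots, one kept with f and one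
      paired with it in Cauchy-Schwarz.\<close>
    let ?r = "\<lambda>x. ennreal (sqrt (gaussian t (x - z)))"
    have r: "(?r x)\<^sup>2 = ennreal (gaussian t (x - z))" for x
      by (simp add: ennreal_power)
    have "ennreal (norm (gaussian_smooth t f z)) \<le> (\<integral>\<^sup>+x. norm (f x * of_real (gaussian t (x - z))) \<partial>lborel)"
      unfolding gaussian_smooth_def
      \<comment> \<open>If the integrand is not integrable the smoothing is 0 by convention, and the
        bound is trivial.\<close>
      by (cases "integrable lborel (\<lambda>x. f x * of_real (gaussian t (x - z)))")
         (auto intro!: integral_norm_bound_ennreal simp: not_integrable_integral_eq)
    also have "\<dots> = (\<integral>\<^sup>+x. (ennreal (norm (f x)) * ?r x) * ?r x \<partial>lborel)"
      by (intro nn_integral_cong) (simp add: norm_mult flip: ennreal_mult mult.assoc)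
    finally have "(ennreal (norm (gaussian_smooth t f z)))\<^sup>2
        \<le> (\<integral>\<^sup>+x. (ennreal (norm (f x)) * ?r x) * ?r x \<partial>lborel)\<^sup>2"
      by (rule power_mono) simp
    also have "\<dots> \<le> (\<integral>\<^sup>+x. (ennreal (norm (f x)) * ?r x)\<^sup>2 \<partial>lborel) * (\<integral>\<^sup>+x. (?r x)\<^sup>2 \<partial>lborel)"
      by (rule Cauchy_Schwarz_nn_integral) measurable
    also have "\<dots> = (\<integral>\<^sup>+x. ennreal ((norm (f x))\<^sup>2) * ennreal (gaussian t (x - z)) \<partial>lborel)"
      unfolding power_mult_distrib r by (simp add: nn_integral_gaussian_translate[OF t] ennreal_power)
    finally show ?thesis
      by (simp add: ennreal_power)
  qed
  then have "(\<integral>\<^sup>+z. ennreal ((norm (gaussian_smooth t f z))\<^sup>2) \<partial>lborel)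
      \<le> (\<integral>\<^sup>+z. \<integral>\<^sup>+x. ennreal ((norm (f x))\<^sup>2) * ennreal (gaussian t (x - z)) \<partial>lborel \<partial>lborel)"
    by (intro nn_integral_mono)
  also have "\<dots> = (\<integral>\<^sup>+x. \<integral>\<^sup>+z. ennreal ((norm (f x))\<^sup>2) * ennreal (gaussian t (x - z)) \<partial>lborel \<partial>lborel)"
    by (rule lborel_pair.Fubini') measurable
  also have "\<dots> = (\<integral>\<^sup>+x. ennreal ((norm (f x))\<^sup>2) * (\<integral>\<^sup>+z. ennreal (gaussian t (z - x)) \<partial>lborel) \<partial>lborel)"
  proof -
    have "gaussian t (x - z) = gaussian t (z - x)" for x z :: 'a
      by (simp add: gaussian_def normal_density_def inner_diff_left power2_commute)
    then show ?thesis
      by (simp add: nn_integral_cmult)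
  qed
  finally show ?thesis
    by (simp add: nn_integral_gaussian_translate[OF t])
qed

text \<open>As the kernel has mass 1, f(z) can be written under the same integral as f(x). The
  substitution x = z + t u then moves \<open>t\<close> out of the kernel and into the translation,
  with \<open>gaussian_scaleR\<close> absorbing the Jacobian. The weight \<open>gaussian 1\<close>
  no longer depends on \<open>t\<close>, which is what dominated convergence as t -> 0
  requires.\<close>

lemma gaussian_smooth_diff_le:
  fixes f :: "'a::euclidean_space \<Rightarrow> complex"
  assumes f: "integrable lborel f" and t: "0 < t"
  shows "(\<integral>\<^sup>+z. ennreal (norm (gaussian_smooth t f z - f z)) \<partial>lborel)
    \<le> (\<integral>\<^sup>+u. ennreal (gaussian 1 u * (LINT z|lborel. norm (f (z + t *\<^sub>R u) - f z))) \<partial>lborel)"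
proof -
  have [measurable]: "f \<in> borel_measurable borel"
    using f by (auto dest: borel_measurable_integrable)
  have "ennreal (norm (gaussian_smooth t f z - f z))
      \<le> (\<integral>\<^sup>+u. ennreal (gaussian 1 u) * ennreal (norm (f (z + t *\<^sub>R u) - f z)) \<partial>lborel)" for z
  proof -
    obtain C where C: "\<And>u::'a. gaussian t u \<le> C"
      using gaussian_bounded[OF t] by blast
    have i1: "integrable lborel (\<lambda>x. f x * of_real (gaussian t (x - z)))"
    proof (rule Bochner_Integration.integrable_bound)
      show "integrable lborel (\<lambda>x. C * norm (f x))"
        using f by simp
      show "AE x in lborel. norm (f x * of_real (gaussian t (x - z))) \<le> norm (C * norm (f x))"
      proof (rule AE_I2)
        fix x
        have "norm (f x * of_real (gaussian t (x - z))) \<le> norm (f x) * C"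
          using C by (simp add: norm_mult mult_left_mono)
        also have "\<dots> \<le> norm (C * norm (f x))"
          by (simp add: mult.commute)
        finally show "norm (f x * of_real (gaussian t (x - z))) \<le> norm (C * norm (f x))" .
      qed
    qed measurable
    have g: "has_bochner_integral lborel (\<lambda>x. gaussian t (x - z)) 1"
      using nn_integral_gaussian_translate[OF t, of z]
      by (intro has_bochner_integral_nn_integral) auto
    have i2: "integrable lborel (\<lambda>x. f z * of_real (gaussian t (x - z)))"
      using g by (intro integrable_mult_right integrable_of_real) (auto simp: has_bochner_integral_iff)
    have "gaussian_smooth t f z - f z = (LINT x|lborel. f x * of_real (gaussian t (x - z)) - f z * of_real (gaussian t (x - z)))"
      using g unfolding gaussian_smooth_def
      by (subst Bochner_Integration.integral_diff[OF i1 i2]) (simp add: has_bochner_integral_iff integral_of_real)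
    also have "ennreal (norm \<dots>) \<le> (\<integral>\<^sup>+x. norm (f x * of_real (gaussian t (x - z)) - f z * of_real (gaussian t (x - z))) \<partial>lborel)"
      by (intro integral_norm_bound_ennreal Bochner_Integration.integrable_diff i1 i2)
    also have "\<dots> = (\<integral>\<^sup>+x. ennreal (gaussian t (x - z) * norm (f x - f z)) \<partial>lborel)"
      by (intro nn_integral_cong) (simp add: norm_mult mult.commute flip: left_diff_distrib)
    also have "\<dots> = (\<integral>\<^sup>+x. ennreal (gaussian t ((x + z) - z) * norm (f (x + z) - f z)) \<partial>lborel)"
      by (rule nn_integral_lborel_translate[symmetric]) measurable
    also have "\<dots> = ennreal (t ^ DIM('a)) * (\<integral>\<^sup>+u. ennreal (gaussian t (t *\<^sub>R u) * norm (f (t *\<^sub>R u + z) - f z)) \<partial>lborel)"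
      using t by (subst nn_integral_lborel_scaleR[where c=t]) simp_all
    also have "\<dots> = (\<integral>\<^sup>+u. ennreal ((gaussian t (t *\<^sub>R u) * t ^ DIM('a)) * norm (f (z + t *\<^sub>R u) - f z)) \<partial>lborel)"
      using t by (subst nn_integral_cmult[symmetric]) (simp_all add: mult_ac add.commute flip: ennreal_mult)
    finally show ?thesis
      unfolding gaussian_scaleR[OF t] by (simp add: ennreal_mult)
  qed
  then have "(\<integral>\<^sup>+z. ennreal (norm (gaussian_smooth t f z - f z)) \<partial>lborel)
      \<le> (\<integral>\<^sup>+z. \<integral>\<^sup>+u. ennreal (gaussian 1 u) * ennreal (norm (f (z + t *\<^sub>R u) - f z)) \<partial>lborel \<partial>lborel)"
    by (intro nn_integral_mono)
  also have "\<dots> = (\<integral>\<^sup>+u. \<integral>\<^sup>+z. ennreal (gaussian 1 u) * ennreal (norm (f (z + t *\<^sub>R u) - f z)) \<partial>lborel \<partial>lborel)"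
    by (rule lborel_pair.Fubini') measurable
  also have "\<dots> = (\<integral>\<^sup>+u. ennreal (gaussian 1 u * (LINT z|lborel. norm (f (z + t *\<^sub>R u) - f z))) \<partial>lborel)"
  proof (rule nn_integral_cong)
    fix u
    have "(\<integral>\<^sup>+z. ennreal (norm (f (z + t *\<^sub>R u) - f z)) \<partial>lborel) = ennreal (LINT z|lborel. norm (f (z + t *\<^sub>R u) - f z))"
      using f by (intro nn_integral_eq_integral integrable_norm Bochner_Integration.integrable_diff integrable_lborel_translate) auto
    then show "(\<integral>\<^sup>+z. ennreal (gaussian 1 u) * ennreal (norm (f (z + t *\<^sub>R u) - f z)) \<partial>lborel)
        = ennreal (gaussian 1 u * (LINT z|lborel. norm (f (z + t *\<^sub>R u) - f z)))"
      by (simp add: nn_integral_cmult ennreal_mult)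
  qed
  finally show ?thesis .
qed

text \<open>In the bound of \<open>gaussian_smooth_diff_le\<close> the inner integral tends to 0 for
  each u by continuity of translation in L^1, and it never exceeds twice the L^1 norm of
  \<open>f\<close>, so \<open>gaussian 1\<close> times that constant is a majorant in u.\<close>

lemma gaussian_smooth_tendsto_L1:
  fixes f :: "'a::euclidean_space \<Rightarrow> complex"
  assumes f: "integrable lborel f" and t: "\<And>k. 0 < t k" "t \<longlonglongrightarrow> 0"
  shows "(\<lambda>k. \<integral>\<^sup>+z. ennreal (norm (gaussian_smooth (t k) f z - f z)) \<partial>lborel) \<longlonglongrightarrow> 0"
proof (rule tendsto_sandwich[OF _ _ tendsto_const])
  have [measurable]: "f \<in> borel_measurable borel"
    using f by (auto dest: borel_measurable_integrable)
  let ?N = "2 * (LINT z|lborel. norm (f z))"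
  have bd: "(LINT z|lborel. norm (f (z + h) - f z)) \<le> ?N" for h
  proof -
    note fh = integrable_lborel_translate[OF f, of h]
    have "(LINT z|lborel. norm (f (z + h) - f z)) \<le> (LINT z|lborel. norm (f (z + h)) + norm (f z))"
      using f fh by (intro integral_mono norm_triangle_ineq4) auto
    also have "\<dots> = ?N"
      using f fh integral_lborel_translate[of "\<lambda>x. norm (f x)" h] by simp
    finally show ?thesis .
  qed
  have "(\<lambda>k. \<integral>\<^sup>+u. ennreal (gaussian 1 u * (LINT z|lborel. norm (f (z + t k *\<^sub>R u) - f z))) \<partial>lborel)
      \<longlonglongrightarrow> (\<integral>\<^sup>+u. 0 \<partial>(lborel :: 'a measure))"
  proof (rule nn_integral_dominated_convergence)
    show "AE u in lborel. ennreal (gaussian 1 u * (LINT z|lborel. norm (f (z + t k *\<^sub>R u) - f z)))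
        \<le> ennreal (gaussian 1 u) * ennreal ?N" for k
      using bd by (auto intro!: AE_I2 ennreal_leI mult_left_mono simp flip: ennreal_mult)
    show "(\<integral>\<^sup>+u. ennreal (gaussian 1 (u::'a)) * ennreal ?N \<partial>lborel) < \<infinity>"
      by (simp add: nn_integral_multc nn_integral_gaussian)
    show "AE u in lborel. (\<lambda>k. ennreal (gaussian 1 u * (LINT z|lborel. norm (f (z + t k *\<^sub>R u) - f z)))) \<longlonglongrightarrow> 0"
    proof (rule AE_I2)
      fix u :: 'a
      have "(\<lambda>k. t k *\<^sub>R u) \<longlonglongrightarrow> 0"
        using tendsto_scaleR[OF t(2) tendsto_const] by simp
      then have "(\<lambda>k. ennreal (gaussian 1 u * (LINT z|lborel. norm (f (z + t k *\<^sub>R u) - f z)))) \<longlonglongrightarrow> ennreal (gaussian 1 u * 0)"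
        by (intro tendsto_ennrealI tendsto_mult_left tendsto_translate_L1[OF f])
      then show "(\<lambda>k. ennreal (gaussian 1 u * (LINT z|lborel. norm (f (z + t k *\<^sub>R u) - f z)))) \<longlonglongrightarrow> 0"
        by simp
    qed
  qed measurable
  then show "(\<lambda>k. \<integral>\<^sup>+u. ennreal (gaussian 1 u * (LINT z|lborel. norm (f (z + t k *\<^sub>R u) - f z))) \<partial>lborel) \<longlonglongrightarrow> 0"
    by simp
qed (use gaussian_smooth_diff_le[OF f t(1)] in auto)

section \<open>Plancherel's theorem for integrable functions\<close>

lemma borel_measurable_fourier_transform [measurable]:
  assumes [measurable]: "f \<in> borel_measurable borel"
  shows "fourier_transform f \<in> borel_measurable borel"
  unfolding fourier_transform_def[abs_def] by measurable

lemma norm_fourier_transform_le: "norm (fourier_transform f \<xi>) \<le> (LINT x|lborel. norm (f x))"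
proof -
  have "norm (fourier_transform f \<xi>) \<le> (LINT x|lborel. norm (f x * exp (- 2 * \<i> * of_real pi * of_real (x \<bullet> \<xi>))))"
    unfolding fourier_transform_def by (rule integral_norm_bound)
  then show ?thesis
    by (simp add: norm_mult)
qed

text \<open>Both sides are instances of \<open>nn_integral_kernel_square\<close>, for the damped
  character \<open>?k\<close> and the translated Gaussian \<open>?l\<close>. The correlation of
  \<open>?k\<close> is a Gaussian Fourier integral, that of \<open>?l\<close> a Gaussian
  convolution, and both equal \<open>gaussian ?s (x - y)\<close>.\<close>

lemma fourier_transform_weighted_l2:
  fixes f :: "'a::euclidean_space \<Rightarrow> complex"
  assumes f: "integrable lborel f" and t: "0 < t"
  shows "(\<integral>\<^sup>+\<xi>. ennreal ((norm (fourier_transform f \<xi>))\<^sup>2 * exp (- (4 * pi\<^sup>2 * t\<^sup>2) * (\<xi> \<bullet> \<xi>))) \<partial>lborel)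
    = (\<integral>\<^sup>+z. ennreal ((norm (gaussian_smooth t f z))\<^sup>2) \<partial>lborel)"
proof -
  \<comment> \<open>Squaring the damping factor doubles its exponent to 4 pi^2 t^2 = 2 pi^2
    \<open>?s\<close>^2, and convolving two Gaussians of variance t^2 also gives variance
    \<open>?s\<close>^2.\<close>
  let ?s = "sqrt 2 * t"
  let ?k = "\<lambda>\<xi> x. exp (- 2 * \<i> * of_real pi * of_real (x \<bullet> \<xi>)) * of_real (exp (- (2 * pi\<^sup>2 * t\<^sup>2) * (\<xi> \<bullet> \<xi>))) :: complex"
  let ?l = "\<lambda>z x. of_real (gaussian t (x - z)) :: complex"
  have s: "0 < ?s" "?s\<^sup>2 = 2 * t\<^sup>2"
    using t by (simp_all add: power_mult_distrib)
  have kk: "norm (?k \<xi> x) * norm (?k \<xi> y) = exp (- (2 * pi\<^sup>2 * ?s\<^sup>2) * (\<xi> \<bullet> \<xi>))" for \<xi> x y :: 'a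
    unfolding s by (simp add: norm_mult flip: exp_add)
  have k_int: "(LINT \<xi>|lborel. ?k \<xi> x * cnj (?k \<xi> y)) = of_real (gaussian ?s (x - y))" for x y :: 'a
  proof -
    have "?k \<xi> x * cnj (?k \<xi> y)
        = of_real (exp (- (2 * pi\<^sup>2 * ?s\<^sup>2) * (\<xi> \<bullet> \<xi>))) * iexp (- (2 * pi * ((x - y) \<bullet> \<xi>)))" for \<xi>
      unfolding s by (simp add: exp_cnj inner_diff_left algebra_simps exp_of_real[symmetric] flip: exp_add)
    then show ?thesis
      by (simp only: gaussian_fourier[OF s(1)])
  qed
  obtain C where C: "\<And>u::'a. gaussian ?s u \<le> C"
    using gaussian_bounded[OF s(1)] by blast
  obtain B where B: "\<And>u::'a. gaussian t u \<le> B"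
    using gaussian_bounded[OF t] by blast
  have l_int: "(LINT z|lborel. ?l z x * cnj (?l z y)) = of_real (gaussian ?s (x - y))" for x y :: 'a
  proof -
    have "has_bochner_integral lborel (\<lambda>z. gaussian t (x - z) * gaussian t (y - z)) (gaussian ?s (x - y))"
      using gaussian_conv[OF t, of x y] by (intro has_bochner_integral_nn_integral) auto
    then have "has_bochner_integral lborel (\<lambda>z. complex_of_real (gaussian t (x - z) * gaussian t (y - z))) (of_real (gaussian ?s (x - y)))"
      by (rule has_bochner_integral_of_real)
    then show ?thesis
      by (simp add: has_bochner_integral_iff)
  qed
  have "(\<integral>\<^sup>+\<xi>. ennreal ((norm (fourier_transform f \<xi>))\<^sup>2 * exp (- (4 * pi\<^sup>2 * t\<^sup>2) * (\<xi> \<bullet> \<xi>))) \<partial>lborel)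
      = (\<integral>\<^sup>+\<xi>. ennreal ((norm (LINT x|lborel. f x * ?k \<xi> x))\<^sup>2) \<partial>lborel)"
  proof (intro nn_integral_cong arg_cong[of _ _ ennreal])
    fix \<xi> :: 'a
    have "(LINT x|lborel. f x * ?k \<xi> x) = fourier_transform f \<xi> * of_real (exp (- (2 * pi\<^sup>2 * t\<^sup>2) * (\<xi> \<bullet> \<xi>)))"
      unfolding fourier_transform_def mult.assoc[symmetric] by (rule integral_mult_left_zero)
    then show "(norm (fourier_transform f \<xi>))\<^sup>2 * exp (- (4 * pi\<^sup>2 * t\<^sup>2) * (\<xi> \<bullet> \<xi>))
        = (norm (LINT x|lborel. f x * ?k \<xi> x))\<^sup>2"
      by (simp add: norm_mult power_mult_distrib power2_eq_square[of "exp _"] flip: exp_add)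
  qed
  also have "\<dots> = ennreal (Re (LINT p|(lborel \<Otimes>\<^sub>M lborel). f (fst p) * cnj (f (snd p))
        * (LINT \<xi>|lborel. ?k \<xi> (fst p) * cnj (?k \<xi> (snd p)))))"
  proof (rule nn_integral_kernel_square[OF f])
    have "(\<integral>\<^sup>+\<xi>. ennreal (exp (- (2 * pi\<^sup>2 * ?s\<^sup>2) * (\<xi> \<bullet> (\<xi>::'a)))) \<partial>lborel)
        = ennreal (LINT \<xi>|lborel. exp (- (2 * pi\<^sup>2 * ?s\<^sup>2) * (\<xi> \<bullet> (\<xi>::'a))))"
      using integrable_gaussian_weight[OF s(1)] by (intro nn_integral_eq_integral) auto
    then show "(\<integral>\<^sup>+\<xi>. ennreal (norm (?k \<xi> x) * norm (?k \<xi> y)) \<partial>lborel)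
        \<le> ennreal (LINT \<xi>|lborel. exp (- (2 * pi\<^sup>2 * ?s\<^sup>2) * (\<xi> \<bullet> (\<xi>::'a))))" for x y :: 'a
      by (simp only: kk order_refl)
    show "norm (?k \<xi> x) \<le> 1" for \<xi> x :: 'a
      by (simp add: norm_mult)
  qed measurable
  also have "\<dots> = ennreal (Re (LINT p|(lborel \<Otimes>\<^sub>M lborel). f (fst p) * cnj (f (snd p))
        * (LINT z|lborel. ?l z (fst p) * cnj (?l z (snd p)))))"
    by (simp only: k_int l_int)
  also have "\<dots> = (\<integral>\<^sup>+z. ennreal ((norm (LINT x|lborel. f x * ?l z x))\<^sup>2) \<partial>lborel)"
  proof (rule nn_integral_kernel_square[OF f, symmetric])
    show "(\<integral>\<^sup>+z. ennreal (norm (?l z x) * norm (?l z y)) \<partial>lborel) \<le> ennreal C" for x y :: 'a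
      using C gaussian_conv[OF t, of x y] by (simp add: ennreal_leI)
    show "norm (?l z x) \<le> B" for z x :: 'a
      using B by simp
  qed measurable
  finally show ?thesis
    unfolding gaussian_smooth_def .
qed

lemma plancherel_L1:
  fixes f :: "'a::euclidean_space \<Rightarrow> complex"
  assumes f: "integrable lborel f"
  shows "(\<integral>\<^sup>+\<xi>. ennreal ((norm (fourier_transform f \<xi>))\<^sup>2) \<partial>lborel) = (\<integral>\<^sup>+x. ennreal ((norm (f x))\<^sup>2) \<partial>lborel)"
proof (rule antisym)
  have f_meas [measurable]: "f \<in> borel_measurable borel"
    using f by (auto dest: borel_measurable_integrable)
  define t where "t k = 1 / real (Suc k)" for k
  have t: "0 < t k" for k
    by (simp add: t_def)
  have t0: "t \<longlonglongrightarrow> 0"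
    unfolding t_def[abs_def] using LIMSEQ_inverse_real_of_nat by (simp add: inverse_eq_divide)
  have "(\<lambda>k. \<integral>\<^sup>+\<xi>. ennreal ((norm (fourier_transform f \<xi>))\<^sup>2 * exp (- (4 * pi\<^sup>2 * (t k)\<^sup>2) * (\<xi> \<bullet> \<xi>))) \<partial>lborel)
      \<longlonglongrightarrow> (\<integral>\<^sup>+\<xi>. ennreal ((norm (fourier_transform f \<xi>))\<^sup>2) \<partial>lborel)"
  \<comment> \<open>Monotone convergence: as \<open>t k\<close> decreases to 0 the damping factor
    increases to 1, so the limit is valid even when it is infinite.\<close>
  proof (rule nn_integral_LIMSEQ)
    have "exp (- (4 * pi\<^sup>2 * (t j)\<^sup>2) * (\<xi> \<bullet> \<xi>)) \<le> exp (- (4 * pi\<^sup>2 * (t k)\<^sup>2) * (\<xi> \<bullet> \<xi>))" if "j \<le> k" for j k and \<xi> :: 'a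
    proof -
      have "t k \<le> t j"
        using that by (simp add: t_def frac_le)
      then have "(t k)\<^sup>2 \<le> (t j)\<^sup>2"
        using t[of k] by (intro power_mono) auto
      then show ?thesis
        by (simp add: mult_right_mono)
    qed
    then show "incseq (\<lambda>k \<xi>. ennreal ((norm (fourier_transform f \<xi>))\<^sup>2 * exp (- (4 * pi\<^sup>2 * (t k)\<^sup>2) * (\<xi> \<bullet> \<xi>))))"
      by (auto simp: incseq_def le_fun_def intro!: ennreal_leI mult_left_mono)
    fix \<xi> :: 'a
    have "(\<lambda>k. ennreal ((norm (fourier_transform f \<xi>))\<^sup>2 * exp (- (4 * pi\<^sup>2 * (t k)\<^sup>2) * (\<xi> \<bullet> \<xi>))))
        \<longlonglongrightarrow> ennreal ((norm (fourier_transform f \<xi>))\<^sup>2 * exp (- (4 * pi\<^sup>2 * 0\<^sup>2) * (\<xi> \<bullet> \<xi>)))"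
      by (intro tendsto_intros tendsto_ennrealI t0)
    then show "(\<lambda>k. ennreal ((norm (fourier_transform f \<xi>))\<^sup>2 * exp (- (4 * pi\<^sup>2 * (t k)\<^sup>2) * (\<xi> \<bullet> \<xi>))))
        \<longlonglongrightarrow> ennreal ((norm (fourier_transform f \<xi>))\<^sup>2)"
      by simp
  qed measurable
  then have lim: "(\<lambda>k. \<integral>\<^sup>+z. ennreal ((norm (gaussian_smooth (t k) f z))\<^sup>2) \<partial>lborel)
      \<longlonglongrightarrow> (\<integral>\<^sup>+\<xi>. ennreal ((norm (fourier_transform f \<xi>))\<^sup>2) \<partial>lborel)"
    by (simp only: fourier_transform_weighted_l2[OF f t])
  show "(\<integral>\<^sup>+\<xi>. ennreal ((norm (fourier_transform f \<xi>))\<^sup>2) \<partial>lborel) \<le> (\<integral>\<^sup>+x. ennreal ((norm (f x))\<^sup>2) \<partial>lborel)"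
    by (rule LIMSEQ_le_const2[OF lim]) (use gaussian_smooth_l2_le[OF f_meas t] in auto)
  have L1: "(\<lambda>k. \<integral>\<^sup>+z. ennreal (norm (gaussian_smooth (t k) f z - f z)) \<partial>lborel) \<longlonglongrightarrow> 0"
    by (rule gaussian_smooth_tendsto_L1[OF f t t0])
  then have "\<forall>\<^sub>F k in sequentially. (\<integral>\<^sup>+z. ennreal (norm (gaussian_smooth (t k) f z - f z)) \<partial>lborel) < \<infinity>"
    by (rule order_tendstoD(2)) simp
  \<comment> \<open>Convergence to 0 in [0, \<infinity>] guarantees finite values only from some
    index on. Shifting by \<open>K\<close> makes every difference integrable, as extracting an
    almost everywhere convergent subsequence requires.\<close>
  then obtain K where K: "(\<integral>\<^sup>+z. ennreal (norm (gaussian_smooth (t k) f z - f z)) \<partial>lborel) < \<infinity>" if "K \<le> k" for k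
    by (auto simp: eventually_sequentially)
  let ?u = "\<lambda>k z. gaussian_smooth (t (k + K)) f z - f z"
  have u: "integrable lborel (?u k)" for k
    using K[of "k + K"] by (intro integrableI_bounded) auto
  have "(\<lambda>k. ennreal (LINT z|lborel. norm (?u k z))) \<longlonglongrightarrow> ennreal 0"
    using LIMSEQ_ignore_initial_segment[OF L1, of K] u by (simp add: nn_integral_eq_integral)
  then have "(\<lambda>k. LINT z|lborel. norm (?u k z)) \<longlonglongrightarrow> 0"
    by (subst (asm) tendsto_ennreal_iff) auto
  from tendsto_L1_AE_subseq[OF u this] obtain r where
    r: "strict_mono r" "AE z in lborel. (\<lambda>k. ?u (r k) z) \<longlonglongrightarrow> 0"
    by auto
  let ?g = "\<lambda>k z. gaussian_smooth (t (r k + K)) f z"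
  have "(\<integral>\<^sup>+x. ennreal ((norm (f x))\<^sup>2) \<partial>lborel) = (\<integral>\<^sup>+z. liminf (\<lambda>k. ennreal ((norm (?g k z))\<^sup>2)) \<partial>lborel)"
  proof (rule nn_integral_cong_AE)
    show "AE z in lborel. ennreal ((norm (f z))\<^sup>2) = liminf (\<lambda>k. ennreal ((norm (?g k z))\<^sup>2))"
      using r(2)
    proof eventually_elim
      case (elim z)
      then have "(\<lambda>k. ?g k z) \<longlonglongrightarrow> f z"
        by (rule LIM_zero_cancel)
      then have "(\<lambda>k. ennreal ((norm (?g k z))\<^sup>2)) \<longlonglongrightarrow> ennreal ((norm (f z))\<^sup>2)"
        by (intro tendsto_ennrealI tendsto_intros)
      then show ?case
        by (rule lim_imp_Liminf[OF sequentially_bot, symmetric])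
    qed
  qed
  also have "\<dots> \<le> liminf (\<lambda>k. \<integral>\<^sup>+z. ennreal ((norm (?g k z))\<^sup>2) \<partial>lborel)"
    by (rule nn_integral_liminf) measurable
  also have "\<dots> = (\<integral>\<^sup>+\<xi>. ennreal ((norm (fourier_transform f \<xi>))\<^sup>2) \<partial>lborel)"
  proof (rule lim_imp_Liminf)
    have "strict_mono (\<lambda>k. r k + K)"
      using r(1) by (simp add: strict_mono_def)
    from LIMSEQ_subseq_LIMSEQ[OF lim this]
    show "(\<lambda>k. \<integral>\<^sup>+z. ennreal ((norm (?g k z))\<^sup>2) \<partial>lborel)
        \<longlonglongrightarrow> (\<integral>\<^sup>+\<xi>. ennreal ((norm (fourier_transform f \<xi>))\<^sup>2) \<partial>lborel)"
      by (simp add: o_def)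
  qed simp
  finally show "(\<integral>\<^sup>+x. ennreal ((norm (f x))\<^sup>2) \<partial>lborel) \<le> (\<integral>\<^sup>+\<xi>. ennreal ((norm (fourier_transform f \<xi>))\<^sup>2) \<partial>lborel)" .
qed

section \<open>Polar coordinates\<close>

lemma nn_integral_power_exp:
  assumes c: "0 < c"
  shows "(\<integral>\<^sup>+r\<in>{0<..}. ennreal (r ^ k * exp (- c * r)) \<partial>lborel) = ennreal (fact k / c ^ Suc k)"
proof -
  let ?I = "\<integral>\<^sup>+r. ennreal (r ^ k * exp (- c * r)) * indicator {0<..} r \<partial>lborel"
  have "ennreal (fact k) = (\<integral>\<^sup>+x. ennreal (x ^ k * exp (- x)) * indicator {0 ..} x \<partial>lborel)"
    by (simp add: nn_intergal_power_times_exp_Ici)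
  also have "\<dots> = ennreal c * (\<integral>\<^sup>+r. ennreal ((c * r) ^ k * exp (- (c * r))) * indicator {0..} (c * r) \<partial>lborel)"
    using c by (subst nn_integral_real_affine[where c=c and t=0]) auto
  also have "(\<integral>\<^sup>+r. ennreal ((c * r) ^ k * exp (- (c * r))) * indicator {0..} (c * r) \<partial>lborel)
      = (\<integral>\<^sup>+r. ennreal (c ^ k) * (ennreal (r ^ k * exp (- c * r)) * indicator {0<..} r) \<partial>lborel)"
  proof (rule nn_integral_cong_AE)
    \<comment> \<open>The half-lines differ only at r = 0, where the two sides disagree when k = 0;
      that point is null.\<close>
    show "AE r in lborel. ennreal ((c * r) ^ k * exp (- (c * r))) * indicator {0..} (c * r)
        = ennreal (c ^ k) * (ennreal (r ^ k * exp (- c * r)) * indicator {0<..} r)"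
      using AE_lborel_singleton[of "0::real"]
    proof eventually_elim
      case (elim r)
      then show ?case
        using c by (auto simp: indicator_def zero_le_mult_iff power_mult_distrib mult.assoc ennreal_mult simp flip: ennreal_mult)
    qed
  qed
  also have "ennreal c * \<dots> = ennreal (c ^ Suc k) * ?I"
    using c by (subst nn_integral_cmult) (auto simp: ennreal_mult mult.assoc)
  finally have *: "ennreal (fact k) = ennreal (c ^ Suc k) * ?I" .
  have "?I = ennreal (1 / c ^ Suc k) * (ennreal (c ^ Suc k) * ?I)"
    using c by (simp add: mult.assoc[symmetric] flip: ennreal_mult)
  also have "\<dots> = ennreal (fact k / c ^ Suc k)"
    using c unfolding *[symmetric] by (simp flip: ennreal_mult)
  finally show ?thesis .
qed

text \<open>With a = norm u this evaluates the last integral in \<open>nn_integral_polar\<close>: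
  the factor n of the cone measure and the factor norm u ^ n cancel against it.\<close>

lemma nn_integral_inverse_power:
  fixes a :: real
  assumes a: "0 < a" and n: "0 < n"
  shows "(\<integral>\<^sup>+s. ennreal (real n / s ^ Suc n) * indicator {a<..} s \<partial>lborel) = ennreal (1 / a ^ n)"
proof -
  have "(\<integral>\<^sup>+s. ennreal (real n / s ^ Suc n) * indicator {a<..} s \<partial>lborel)
      = (\<integral>\<^sup>+s. ennreal (real n / s ^ Suc n) * indicator {a..} s \<partial>lborel)"
  proof (rule nn_integral_cong_AE)
    show "AE s in lborel. ennreal (real n / s ^ Suc n) * indicator {a<..} s
        = ennreal (real n / s ^ Suc n) * indicator {a..} s"
      using AE_lborel_singleton[of a] by eventually_elim (auto simp: indicator_def)
  qed
  also have "\<dots> = ennreal (0 - (- (1 / a ^ n)))"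
  proof (rule nn_integral_FTC_atLeast)
    show "((\<lambda>s. - (1 / s ^ n)) has_real_derivative real n / x ^ Suc n) (at x)" if "a \<le> x" for x
    proof -
      have "0 < x"
        using a that by simp
      moreover have "x ^ n = x * x ^ (n - Suc 0)"
        using n by (simp add: power_eq_if)
      ultimately show ?thesis
        by (auto intro!: derivative_eq_intros simp: field_simps)
    qed
    show "((\<lambda>s::real. - (1 / s ^ n)) \<longlongrightarrow> 0) at_top"
    proof -
      have "((\<lambda>s::real. - ((1 / s) ^ n)) \<longlongrightarrow> - (0 ^ n)) at_top"
        by (intro tendsto_intros tendsto_divide_0[OF tendsto_const] filterlim_at_top_imp_at_infinity filterlim_ident)
      then show ?thesis
        using n by (simp add: power_one_over power_0_left)
    qed
    show "0 \<le> real n / x ^ Suc n" if "a \<le> x" for x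
      using a that by simp
  qed measurable
  finally show ?thesis
    by simp
qed

lemma measurable_sgn_sphere:
  "sgn \<in> measurable (restrict_space lborel (ball 0 1 - {0})) (restrict_space borel (sphere (0::real ^ 'n) 1))"
  by (intro measurable_restrict_space2 measurable_restrict_space1)
     (auto simp: space_restrict_space norm_sgn)

lemma nn_integral_surface_measure:
  fixes h :: "real ^ 'n \<Rightarrow> ennreal"
  assumes "h \<in> borel_measurable borel"
  shows "(\<integral>\<^sup>+\<theta>. h \<theta> \<partial>surface_measure)
    = of_nat CARD('n) * (\<integral>\<^sup>+x. h (sgn x) * indicator (ball 0 1 - {0}) x \<partial>lborel)"
  using measurable_restrict_space1[OF assms, of "sphere 0 1"]
  by (simp add: surface_measure_def nn_integral_scale_measure
      nn_integral_distr[OF measurable_sgn_sphere] nn_integral_restrict_space)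

text \<open>By the cone measure the outer integral is n times an integral over x in the unit ball,
  with \<theta> = x/|x|. Rescaling r by |x| replaces r \<theta> by s x, and for fixed s the dilation
  u = s x moves the argument of \<open>h\<close> to u alone. What remains is an explicit integral in
  s > |u|, which equals 1. Only dilations and Tonelli are used.\<close>

lemma nn_integral_polar:
  fixes h :: "real ^ 'n \<Rightarrow> ennreal"
  assumes [measurable]: "h \<in> borel_measurable borel"
  shows "(\<integral>\<^sup>+\<theta>. (\<integral>\<^sup>+r\<in>{0<..}. h (r *\<^sub>R \<theta>) * ennreal (r ^ (CARD('n) - 1)) \<partial>lborel) \<partial>surface_measure)
    = (\<integral>\<^sup>+x. h x \<partial>lborel)"
proof -
  define n where "n = CARD('n)"
  have n: "0 < n" "DIM(real ^ 'n) = n"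
    by (simp_all add: n_def)
  have pow: "a ^ n = a * a ^ (n - 1)" for a :: real
    using n(1) by (simp add: power_eq_if)
  have [measurable]: "(\<lambda>(s, u). indicator {norm u<..} s :: ennreal) \<in> borel_measurable (borel \<Otimes>\<^sub>M (borel :: (real ^ 'n) measure))"
  proof -
    have "(\<lambda>(s, u). indicator {norm u<..} s :: ennreal) = indicator {p. norm (snd p :: real ^ 'n) < fst p}"
      by (auto simp: fun_eq_iff indicator_def)
    then show ?thesis
      by simp
  qed
  \<comment> \<open>The origin is removed because \<open>sgn 0 = 0\<close> is not a unit vector;
    \<open>Z\<close> keeps that condition after the dilation.\<close>
  define B :: "(real ^ 'n) set" where "B = ball 0 1 - {0}"
  define Z :: "(real ^ 'n) set" where "Z = - {0}"
  have [measurable]: "B \<in> sets borel" "Z \<in> sets borel"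
    by (simp_all add: B_def Z_def)
  have "(\<integral>\<^sup>+\<theta>. (\<integral>\<^sup>+r. h (r *\<^sub>R \<theta>) * ennreal (r ^ (n - 1)) * indicator {0<..} r \<partial>lborel) \<partial>surface_measure)
      = of_nat n * (\<integral>\<^sup>+x. (\<integral>\<^sup>+r. h (r *\<^sub>R sgn x) * ennreal (r ^ (n - 1)) * indicator {0<..} r \<partial>lborel) * indicator B x \<partial>lborel)"
    unfolding n_def B_def by (rule nn_integral_surface_measure) measurable
  \<comment> \<open>Substitution r = |x| s: the n - 1 factors |x| from the power of r and one from
    dr make |x|^n.\<close>
  also have "\<dots> = of_nat n * (\<integral>\<^sup>+x. (\<integral>\<^sup>+s. h (s *\<^sub>R x) * ennreal (s ^ (n - 1) * norm x ^ n) * indicator {0<..} s * indicator B x \<partial>lborel) \<partial>lborel)"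
  proof (intro arg_cong[of _ _ "(*) (of_nat n)"] nn_integral_cong)
    fix x :: "real ^ 'n"
    show "(\<integral>\<^sup>+r. h (r *\<^sub>R sgn x) * ennreal (r ^ (n - 1)) * indicator {0<..} r \<partial>lborel) * indicator B x
        = (\<integral>\<^sup>+s. h (s *\<^sub>R x) * ennreal (s ^ (n - 1) * norm x ^ n) * indicator {0<..} s * indicator B x \<partial>lborel)"
    proof (cases "x \<in> B")
      case True
      then have x: "0 < norm x"
        by (simp add: B_def)
      have "(\<integral>\<^sup>+r. h (r *\<^sub>R sgn x) * ennreal (r ^ (n - 1)) * indicator {0<..} r \<partial>lborel)
          = ennreal (norm x) * (\<integral>\<^sup>+s. h ((norm x * s) *\<^sub>R sgn x) * ennreal ((norm x * s) ^ (n - 1)) * indicator {0<..} (norm x * s) \<partial>lborel)"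
        using x by (subst nn_integral_real_affine[where c="norm x" and t=0]) auto
      also have "\<dots> = (\<integral>\<^sup>+s. ennreal (norm x) * (h ((norm x * s) *\<^sub>R sgn x) * ennreal ((norm x * s) ^ (n - 1)) * indicator {0<..} (norm x * s)) \<partial>lborel)"
        by (rule nn_integral_cmult[symmetric]) measurable
      also have "\<dots> = (\<integral>\<^sup>+s. h (s *\<^sub>R x) * ennreal (s ^ (n - 1) * norm x ^ n) * indicator {0<..} s \<partial>lborel)"
      proof (rule nn_integral_cong)
        fix s :: real
        show "ennreal (norm x) * (h ((norm x * s) *\<^sub>R sgn x) * ennreal ((norm x * s) ^ (n - 1)) * indicator {0<..} (norm x * s))
            = h (s *\<^sub>R x) * ennreal (s ^ (n - 1) * norm x ^ n) * indicator {0<..} s"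
        proof (cases "0 < s")
          case True
          have "(norm x * s) *\<^sub>R sgn x = s *\<^sub>R x"
            using x by (simp add: sgn_div_norm)
          moreover have "ennreal (norm x) * ennreal ((norm x * s) ^ (n - 1)) = ennreal (s ^ (n - 1) * norm x ^ n)"
            using True by (simp add: pow[of "norm x"] power_mult_distrib mult_ac flip: ennreal_mult)
          ultimately show ?thesis
            using True x by (simp add: mult.left_commute[of "ennreal (norm x)"])
        next
          case False
          then show ?thesis
            using x by (simp add: zero_less_mult_iff)
        qed
      qed
      finally show ?thesis
        using True by simp
    qed simp
  qed
  also have "\<dots> = of_nat n * (\<integral>\<^sup>+s. (\<integral>\<^sup>+x. h (s *\<^sub>R x) * ennreal (s ^ (n - 1) * norm x ^ n) * indicator {0<..} s * indicator B x \<partial>lborel) \<partial>lborel)"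
    by (intro arg_cong[of _ _ "(*) (of_nat n)"] lborel_pair.Fubini') measurable
  \<comment> \<open>Substitution u = s x: |x|^n gives |u|^n / s^n and dx gives s^(-n), so s^(n-1)
    becomes 1 / s^(n+1); the unit ball becomes |u| < s.\<close>
  also have "\<dots> = of_nat n * (\<integral>\<^sup>+s. (\<integral>\<^sup>+u. h u * ennreal (norm u ^ n / s ^ Suc n) * indicator {norm u<..} s * indicator Z u \<partial>lborel) \<partial>lborel)"
  proof (rule arg_cong[of _ _ "(*) (of_nat n)"], rule nn_integral_cong)
    fix s :: real
    show "(\<integral>\<^sup>+x. h (s *\<^sub>R x) * ennreal (s ^ (n - 1) * norm x ^ n) * indicator {0<..} s * indicator B x \<partial>lborel)
       = (\<integral>\<^sup>+u. h u * ennreal (norm u ^ n / s ^ Suc n) * indicator {norm u<..} s * indicator Z u \<partial>lborel)"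
    proof (cases "0 < s")
      case True
      have "(\<integral>\<^sup>+u. h u * ennreal (norm u ^ n / s ^ Suc n) * indicator {norm u<..} s * indicator Z u \<partial>lborel)
        = ennreal (s ^ n) * (\<integral>\<^sup>+x. h (s *\<^sub>R x) * ennreal (norm (s *\<^sub>R x) ^ n / s ^ Suc n) * indicator {norm (s *\<^sub>R x)<..} s * indicator Z (s *\<^sub>R x) \<partial>lborel)"
        using True n(2) by (subst nn_integral_lborel_scaleR[where c=s]) simp_all
      also have "\<dots> = (\<integral>\<^sup>+x. ennreal (s ^ n) * (h (s *\<^sub>R x) * ennreal (norm (s *\<^sub>R x) ^ n / s ^ Suc n) * indicator {norm (s *\<^sub>R x)<..} s * indicator Z (s *\<^sub>R x)) \<partial>lborel)"
        by (rule nn_integral_cmult[symmetric]) measurable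
      also have "\<dots> = (\<integral>\<^sup>+x. h (s *\<^sub>R x) * ennreal (s ^ (n - 1) * norm x ^ n) * indicator {0<..} s * indicator B x \<partial>lborel)"
      proof (rule nn_integral_cong)
        fix x :: "real ^ 'n"
        have 1: "ennreal (s ^ n) * ennreal (norm (s *\<^sub>R x) ^ n / s ^ Suc n) = ennreal (s ^ (n - 1) * norm x ^ n)"
          using True by (simp add: pow[of s] power_mult_distrib flip: ennreal_mult)
        have 2: "indicator {norm (s *\<^sub>R x)<..} s * indicator Z (s *\<^sub>R x) = (indicator B x :: ennreal)"
          using True by (simp add: indicator_def B_def Z_def)
        have "ennreal (s ^ n) * (h (s *\<^sub>R x) * ennreal (norm (s *\<^sub>R x) ^ n / s ^ Suc n) * indicator {norm (s *\<^sub>R x)<..} s * indicator Z (s *\<^sub>R x))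
            = h (s *\<^sub>R x) * (ennreal (s ^ n) * ennreal (norm (s *\<^sub>R x) ^ n / s ^ Suc n)) * (indicator {norm (s *\<^sub>R x)<..} s * indicator Z (s *\<^sub>R x))"
          by (simp only: mult_ac)
        then show "ennreal (s ^ n) * (h (s *\<^sub>R x) * ennreal (norm (s *\<^sub>R x) ^ n / s ^ Suc n) * indicator {norm (s *\<^sub>R x)<..} s * indicator Z (s *\<^sub>R x))
            = h (s *\<^sub>R x) * ennreal (s ^ (n - 1) * norm x ^ n) * indicator {0<..} s * indicator B x"
          unfolding 1 2 using True by simp
      qed
      finally show ?thesis ..
    next
      case False
      then have "indicator {norm u<..} s = (0::ennreal)" for u :: "real ^ 'n"
        using order.trans[OF norm_ge_zero[of u], of s] by (auto simp: indicator_def)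
      with False show ?thesis
        by simp
    qed
  qed
  also have "\<dots> = of_nat n * (\<integral>\<^sup>+u. (\<integral>\<^sup>+s. h u * ennreal (norm u ^ n / s ^ Suc n) * indicator {norm u<..} s * indicator Z u \<partial>lborel) \<partial>lborel)"
    by (intro arg_cong[of _ _ "(*) (of_nat n)"] lborel_pair.Fubini') measurable
  also have "\<dots> = (\<integral>\<^sup>+u. of_nat n * (\<integral>\<^sup>+s. h u * ennreal (norm u ^ n / s ^ Suc n) * indicator {norm u<..} s * indicator Z u \<partial>lborel) \<partial>lborel)"
    by (rule nn_integral_cmult[symmetric]) measurable
  also have "\<dots> = (\<integral>\<^sup>+u. h u \<partial>lborel)"
  proof (rule nn_integral_cong_AE)
    show "AE u in lborel. of_nat n * (\<integral>\<^sup>+s. h u * ennreal (norm u ^ n / s ^ Suc n) * indicator {norm u<..} s * indicator Z u \<partial>lborel) = h u"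
      using AE_lborel_singleton[of "0 :: real ^ 'n"]
    proof eventually_elim
      case (elim u)
      then have u: "0 < norm u"
        by simp
      have "of_nat n * (\<integral>\<^sup>+s. h u * ennreal (norm u ^ n / s ^ Suc n) * indicator {norm u<..} s * indicator Z u \<partial>lborel)
          = (\<integral>\<^sup>+s. of_nat n * (h u * ennreal (norm u ^ n / s ^ Suc n) * indicator {norm u<..} s) \<partial>lborel)"
        using elim by (subst nn_integral_cmult) (simp_all add: Z_def)
      also have "\<dots> = (\<integral>\<^sup>+s. h u * ennreal (norm u ^ n) * (ennreal (real n / s ^ Suc n) * indicator {norm u<..} s) \<partial>lborel)"
      proof (rule nn_integral_cong)
        fix s :: real
        show "of_nat n * (h u * ennreal (norm u ^ n / s ^ Suc n) * indicator {norm u<..} s)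
            = h u * ennreal (norm u ^ n) * (ennreal (real n / s ^ Suc n) * indicator {norm u<..} s)"
        proof (cases "norm u < s")
          case True
          with u have "0 < s"
            by linarith
          then have "of_nat n * ennreal (norm u ^ n / s ^ Suc n) = ennreal (norm u ^ n) * ennreal (real n / s ^ Suc n)"
            by (simp add: ennreal_of_nat_eq_real_of_nat mult.commute del: power_Suc flip: ennreal_mult)
          with True show ?thesis
            by (simp add: mult.assoc mult.left_commute[of "of_nat n"])
        qed simp
      qed
      also have "\<dots> = h u * ennreal (norm u ^ n) * ennreal (1 / norm u ^ n)"
        using u n(1) by (subst nn_integral_cmult) (simp_all only: nn_integral_inverse_power, measurable)
      also have "\<dots> = h u"
        using u by (simp add: mult.assoc flip: ennreal_mult)
      finally show ?case .
    qed
  qed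
  finally show ?thesis
    by (simp add: n_def)
qed

section \<open>The radial transform\<close>

text \<open>The transforms agree at every point, since a null set does not affect the integral
  defining them. Almost everywhere equality in R^n would say nothing about the values along a single
  ray, which is what the radial transform reads.\<close>

lemma fourier_eq_fourier_transform:
  fixes f :: "real ^ 'n \<Rightarrow> complex"
  assumes g: "g \<in> borel_measurable borel" and f: "integrable lebesgue f" and fg: "AE x in lborel. f x = g x"
  shows "fourier f = fourier_transform g"
proof
  fix \<xi> :: "real ^ 'n"
  let ?e = "\<lambda>x. exp (- 2 * \<i> * of_real pi * of_real (x \<bullet> \<xi>)) :: complex"
  have [measurable]: "g \<in> borel_measurable borel" "f \<in> borel_measurable lebesgue"
    using g f by auto
  have e: "?e \<in> borel_measurable borel"
    by measurable
  have "fourier f \<xi> = (LINT x|lebesgue. g x * ?e x)"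
    unfolding fourier_def
  proof (rule integral_cong_AE)
    show "AE x in lebesgue. f x * ?e x = g x * ?e x"
      using AE_completion[OF fg] by eventually_elim simp
    show "(\<lambda>x. f x * ?e x) \<in> borel_measurable lebesgue"
      using measurable_completion[of ?e lborel borel] e by simp
    show "(\<lambda>x. g x * ?e x) \<in> borel_measurable lebesgue"
      by (rule measurable_completion) measurable
  qed
  also have "\<dots> = fourier_transform g \<xi>"
    unfolding fourier_transform_def by (rule integral_completion) measurable
  finally show "fourier f \<xi> = fourier_transform g \<xi>" .
qed

lemma integrable_lebesgue_borel_representative:
  fixes f :: "real ^ 'n \<Rightarrow> complex"
  assumes f: "integrable lebesgue f"
  obtains g where "integrable lborel g" "AE x in lborel. f x = g x"
proof -
  have [measurable]: "f \<in> borel_measurable lebesgue"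
    using f by auto
  have "(\<lambda>x. Re (f x)) \<in> borel_measurable lebesgue"
    by measurable
  from completion_ex_borel_measurable_real[OF this] obtain a where
    a: "a \<in> borel_measurable lborel" "AE x in lborel. Re (f x) = a x"
    by blast
  have "(\<lambda>x. Im (f x)) \<in> borel_measurable lebesgue"
    by measurable
  from completion_ex_borel_measurable_real[OF this] obtain b where
    b: "b \<in> borel_measurable lborel" "AE x in lborel. Im (f x) = b x"
    by blast
  define g where "g x = Complex (a x) (b x)" for x
  have [measurable]: "g \<in> borel_measurable borel"
    using a(1) b(1) unfolding g_def[abs_def] by (auto simp: Complex_eq)
  have fg: "AE x in lborel. f x = g x"
    using a(2) b(2) by eventually_elim (simp add: g_def complex_eq_iff)
  have "integrable lebesgue g"
    using f by (rule integrable_cong_AE_imp) (use AE_completion[OF fg] in \<open>auto intro: measurable_completion\<close>)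
  then have "integrable lborel g"
    by (simp add: integrable_completion)
  with fg show ?thesis
    using that by blast
qed

text \<open>Boundedness of the transform is enough to apply \<open>plancherel_L1\<close> on the
  line: for y > 0 the exponential makes the profile integrable despite the growing power of r. The
  identity holds for every \<theta>, so it can be rewritten directly under the surface
  integral.\<close>

lemma radial_transform_l2:
  fixes f :: "real ^ 'n \<Rightarrow> complex"
  assumes f: "fourier f \<in> borel_measurable borel" "\<And>\<xi>. norm (fourier f \<xi>) \<le> M" and y: "0 < y"
  shows "(\<integral>\<^sup>+t. ennreal ((cmod (radial_transform f \<theta> (Complex t y)))\<^sup>2) \<partial>lborel)
    = (\<integral>\<^sup>+r\<in>{0<..}. ennreal ((cmod (fourier f (r *\<^sub>R \<theta>)))\<^sup>2 * r ^ (2 * (CARD('n) - 1)) * exp (- (4 * pi * r * y))) \<partial>lborel)"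
proof -
  define n where "n = CARD('n) - 1"
  note f(1) [measurable]
  \<comment> \<open>Everything except the oscillation exp(2 pi i r t), extended by 0 to negative r
    so that a half-line integral becomes a transform on the whole line.\<close>
  define q where "q r = indicator {0<..} r *\<^sub>R (of_real (exp (- (2 * pi * y) * r) * r ^ n) * fourier f (r *\<^sub>R \<theta>))" for r
  have [measurable]: "q \<in> borel_measurable borel"
    unfolding q_def[abs_def] by measurable
  have M: "0 \<le> M"
    using f(2)[of 0] norm_ge_zero by (rule order_trans[rotated])
  have "(\<integral>\<^sup>+r. ennreal (norm (q r)) \<partial>lborel)
      \<le> (\<integral>\<^sup>+r. ennreal M * (ennreal (r ^ n * exp (- (2 * pi * y) * r)) * indicator {0<..} r) \<partial>lborel)"
  proof (rule nn_integral_mono)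
    fix r :: real
    show "ennreal (norm (q r)) \<le> ennreal M * (ennreal (r ^ n * exp (- (2 * pi * y) * r)) * indicator {0<..} r)"
    proof (cases "0 < r")
      case True
      then have "norm (q r) = r ^ n * exp (- (2 * pi * y) * r) * norm (fourier f (r *\<^sub>R \<theta>))"
        by (simp add: q_def norm_mult norm_power)
      also have "\<dots> \<le> r ^ n * exp (- (2 * pi * y) * r) * M"
        using True f(2) by (intro mult_left_mono) auto
      finally show ?thesis
        using True M by (simp add: ennreal_leI mult.commute flip: ennreal_mult)
    qed (simp add: q_def)
  qed
  also have "\<dots> = ennreal M * ennreal (fact n / (2 * pi * y) ^ Suc n)"
    using y by (subst nn_integral_cmult) (measurable, subst nn_integral_power_exp, simp_all)
  also have "\<dots> < \<infinity>"
    by (simp add: ennreal_mult_less_top)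
  finally have q: "integrable lborel q"
    by (intro integrableI_bounded) auto
  \<comment> \<open>The oscillation has the sign opposite to that of the Fourier kernel, hence the
    frequency -t. It is written as \<open>0 + -1 * t\<close> to fit the affine substitution that
    later removes the reflection.\<close>
  have F: "radial_transform f \<theta> (Complex t y) = fourier_transform q (0 + -1 * t)" for t
    unfolding radial_transform_def fourier_transform_def set_lebesgue_integral_def
  proof (rule Bochner_Integration.integral_cong[OF refl])
    fix r :: real
    have "exp (2 * \<i> * of_real pi * of_real r * Complex t y)
        = of_real (exp (- (2 * pi * y) * r)) * exp (- 2 * \<i> * of_real pi * of_real (r \<bullet> (0 + -1 * t)))"
      unfolding exp_of_real[symmetric] exp_add[symmetric] by (intro arg_cong[of _ _ exp]) (simp add: complex_eq_iff)
    then show "indicator {0<..} r *\<^sub>R (exp (2 * \<i> * of_real pi * of_real r * Complex t y) * fourier f (r *\<^sub>R \<theta>) * of_real (r ^ (CARD('n) - 1)))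
        = q r * exp (- 2 * \<i> * of_real pi * of_real (r \<bullet> (0 + -1 * t)))"
      by (simp only: q_def n_def scaleR_conv_of_real of_real_mult mult_ac)
  qed
  have "(\<integral>\<^sup>+t. ennreal ((cmod (radial_transform f \<theta> (Complex t y)))\<^sup>2) \<partial>lborel)
      = (\<integral>\<^sup>+t. ennreal ((cmod (fourier_transform q t))\<^sup>2) \<partial>lborel)"
    unfolding F by (subst (2) nn_integral_real_affine[where c="-1" and t=0]) simp_all
  also have "\<dots> = (\<integral>\<^sup>+r. ennreal ((cmod (q r))\<^sup>2) \<partial>lborel)"
    by (rule plancherel_L1[OF q])
  also have "\<dots> = (\<integral>\<^sup>+r\<in>{0<..}. ennreal ((cmod (fourier f (r *\<^sub>R \<theta>)))\<^sup>2 * r ^ (2 * n) * exp (- (4 * pi * r * y))) \<partial>lborel)"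
  proof (rule nn_integral_cong)
    fix r :: real
    have "(exp (- (2 * pi * y) * r))\<^sup>2 = exp (- (4 * pi * r * y))"
      by (simp add: power2_eq_square mult_ac flip: exp_add)
    then show "ennreal ((cmod (q r))\<^sup>2)
        = ennreal ((cmod (fourier f (r *\<^sub>R \<theta>)))\<^sup>2 * r ^ (2 * n) * exp (- (4 * pi * r * y))) * indicator {0<..} r"
      by (auto simp: q_def norm_mult norm_power power_mult_distrib mult_ac indicator_def power_mult[symmetric])
  qed
  finally show ?thesis
    by (simp add: n_def)
qed

text \<open>After Tonelli the y-integral is \<open>nn_integral_power_exp\<close> with k = n - 2 and
  c = 4 pi r, that is (n-2)! / (4 pi r)^(n-1). It takes r^(n-1) out of r^(2(n-1)), leaving the polar
  density.\<close>

lemma radial_transform_weighted_l2: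
  fixes f :: "real ^ 'n \<Rightarrow> complex"
  assumes f: "fourier f \<in> borel_measurable borel" "\<And>\<xi>. norm (fourier f \<xi>) \<le> M" and n: "2 \<le> CARD('n)"
  shows "(\<integral>\<^sup>+ y\<in>{0<..}. (\<integral>\<^sup>+ t. ennreal ((cmod (radial_transform f \<theta> (Complex t y)))\<^sup>2 * y ^ (CARD('n) - 2)) \<partial>lborel) \<partial>lborel)
    = (\<integral>\<^sup>+r\<in>{0<..}. ennreal (fact (CARD('n) - 2) / (4 * pi) ^ (CARD('n) - 1) * (cmod (fourier f (r *\<^sub>R \<theta>)))\<^sup>2)
        * ennreal (r ^ (CARD('n) - 1)) \<partial>lborel)"
proof -
  define m where "m = CARD('n) - 2"
  have m: "CARD('n) - 1 = Suc m"
    using n by (simp add: m_def)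
  note f(1) [measurable]
  let ?a = "\<lambda>r. (cmod (fourier f (r *\<^sub>R \<theta>)))\<^sup>2 * r ^ (2 * Suc m)"
  let ?G = "\<lambda>y r. ennreal (?a r) * indicator {0<..} r * (ennreal (y ^ m * exp (- (4 * pi * r) * y)) * indicator {0<..} y)"
  have "(\<integral>\<^sup>+ t. ennreal ((cmod (radial_transform f \<theta> (Complex t y)))\<^sup>2 * y ^ m) \<partial>lborel) * indicator {0<..} y
      = (\<integral>\<^sup>+r. ?G y r \<partial>lborel)" for y
  proof (cases "0 < y")
    case True
    have [measurable]: "(\<lambda>t. radial_transform f \<theta> (Complex t y)) \<in> borel_measurable borel"
      unfolding radial_transform_def set_lebesgue_integral_def Complex_eq by measurable
    have "(\<integral>\<^sup>+ t. ennreal ((cmod (radial_transform f \<theta> (Complex t y)))\<^sup>2 * y ^ m) \<partial>lborel)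
        = (\<integral>\<^sup>+ t. ennreal ((cmod (radial_transform f \<theta> (Complex t y)))\<^sup>2) \<partial>lborel) * ennreal (y ^ m)"
      using True by (simp add: ennreal_mult nn_integral_multc)
    also have "\<dots> = (\<integral>\<^sup>+r. ennreal (?a r * exp (- (4 * pi * r * y))) * indicator {0<..} r * ennreal (y ^ m) \<partial>lborel)"
      unfolding radial_transform_l2[OF f True] m by (rule nn_integral_multc[symmetric]) measurable
    also have "\<dots> = (\<integral>\<^sup>+r. ?G y r \<partial>lborel)"
      using True
      by (intro nn_integral_cong) (auto simp: indicator_def mult_ac simp flip: ennreal_mult)
    finally show ?thesis
      using True by simp
  qed simp
  then have "(\<integral>\<^sup>+ y\<in>{0<..}. (\<integral>\<^sup>+ t. ennreal ((cmod (radial_transform f \<theta> (Complex t y)))\<^sup>2 * y ^ m) \<partial>lborel) \<partial>lborel)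
      = (\<integral>\<^sup>+y. \<integral>\<^sup>+r. ?G y r \<partial>lborel \<partial>lborel)"
    by simp
  also have "\<dots> = (\<integral>\<^sup>+r. \<integral>\<^sup>+y. ?G y r \<partial>lborel \<partial>lborel)"
    by (intro lborel_pair.Fubini'[symmetric]) measurable
  also have "\<dots> = (\<integral>\<^sup>+r. ennreal (fact m / (4 * pi) ^ Suc m * (cmod (fourier f (r *\<^sub>R \<theta>)))\<^sup>2)
        * ennreal (r ^ Suc m) * indicator {0<..} r \<partial>lborel)"
  proof (rule nn_integral_cong)
    fix r :: real
    show "(\<integral>\<^sup>+y. ?G y r \<partial>lborel) = ennreal (fact m / (4 * pi) ^ Suc m * (cmod (fourier f (r *\<^sub>R \<theta>)))\<^sup>2)
        * ennreal (r ^ Suc m) * indicator {0<..} r"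
    proof (cases "0 < r")
      case True
      then have ind: "indicator {0<..} r = (1::ennreal)"
        by simp
      have "(\<integral>\<^sup>+y. ?G y r \<partial>lborel) = ennreal (?a r) * ennreal (fact m / (4 * pi * r) ^ Suc m)"
        using True by (subst nn_integral_cmult) (measurable, subst nn_integral_power_exp, simp_all)
      also have "\<dots> = ennreal (?a r * (fact m / (4 * pi * r) ^ Suc m))"
        using True by (intro ennreal_mult[symmetric]) auto
      also have "?a r * (fact m / (4 * pi * r) ^ Suc m)
          = (fact m / (4 * pi) ^ Suc m * (cmod (fourier f (r *\<^sub>R \<theta>)))\<^sup>2) * r ^ Suc m"
        using True unfolding power_mult_distrib mult_2 power_add by (simp del: power_Suc)
      also have "ennreal \<dots> = ennreal (fact m / (4 * pi) ^ Suc m * (cmod (fourier f (r *\<^sub>R \<theta>)))\<^sup>2) * ennreal (r ^ Suc m)"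
        using True by (intro ennreal_mult) auto
      finally show ?thesis
        by (simp only: ind mult_1_right)
    qed simp
  qed
  finally show ?thesis
    by (simp only: m m_def)
qed

(* The equality is in [0, \<infinity>], so f need not be square integrable. The source prints the
   constant without the factor (n - 2)! = Gamma(n - 1), which equals 1 only for n = 2 and n = 3.
   It arises from the integral of y^(n-2) exp(-4 pi r y) over y > 0, which is
   (n - 2)! / (4 pi r)^(n-1), and without it the identity fails for every n >= 4. *)
theorem mainTheorem4:
  fixes f :: "real^'n \<Rightarrow> complex"
  assumes "CARD('n) \<ge> 2"
    and "integrable lebesgue f"
  shows "(\<integral>\<^sup>+ \<theta>. (\<integral>\<^sup>+ y\<in>{0<..}. (\<integral>\<^sup>+ t.
             ennreal ((cmod (radial_transform f \<theta> (Complex t y)))\<^sup>2 * y ^ (CARD('n) - 2))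
             \<partial>lborel) \<partial>lborel) \<partial>surface_measure)
         = ennreal (fact (CARD('n) - 2) / (4 * pi) ^ (CARD('n) - 1))
           * (\<integral>\<^sup>+ x. ennreal ((cmod (f x))\<^sup>2) \<partial>lebesgue)"
proof -
  obtain g where g: "integrable lborel g" and fg: "AE x in lborel. f x = g x"
    using integrable_lebesgue_borel_representative[OF assms(2)] by blast
  have [measurable]: "g \<in> borel_measurable borel"
    using g by (auto dest: borel_measurable_integrable)
  have F: "fourier f = fourier_transform g"
    by (rule fourier_eq_fourier_transform[OF _ assms(2) fg]) measurable
  have F_meas [measurable]: "fourier f \<in> borel_measurable borel"
    unfolding F by measurable
  have bd: "norm (fourier f \<xi>) \<le> (LINT x|lborel. norm (g x))" for \<xi>
    unfolding F by (rule norm_fourier_transform_le)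
  let ?c = "fact (CARD('n) - 2) / (4 * pi) ^ (CARD('n) - 1) :: real"
  have "(\<integral>\<^sup>+ \<theta>. (\<integral>\<^sup>+ y\<in>{0<..}. (\<integral>\<^sup>+ t.
             ennreal ((cmod (radial_transform f \<theta> (Complex t y)))\<^sup>2 * y ^ (CARD('n) - 2))
             \<partial>lborel) \<partial>lborel) \<partial>surface_measure)
      = (\<integral>\<^sup>+x. ennreal (?c * (cmod (fourier f x))\<^sup>2) \<partial>lborel)"
    \<comment> \<open>The constant stays inside the integrand, so the inner integral already has the
      shape required by \<open>nn_integral_polar\<close>, with \<open>?c\<close> times the squared
      transform as \<open>h\<close>.\<close>
    unfolding radial_transform_weighted_l2[OF F_meas bd assms(1)]
    by (rule nn_integral_polar) measurable
  also have "\<dots> = (\<integral>\<^sup>+x. ennreal ?c * ennreal ((cmod (fourier f x))\<^sup>2) \<partial>lborel)"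
    by (intro nn_integral_cong ennreal_mult) simp_all
  also have "\<dots> = ennreal ?c * (\<integral>\<^sup>+x. ennreal ((cmod (fourier_transform g x))\<^sup>2) \<partial>lborel)"
    unfolding F by (rule nn_integral_cmult) measurable
  also have "\<dots> = ennreal ?c * (\<integral>\<^sup>+x. ennreal ((cmod (g x))\<^sup>2) \<partial>lborel)"
    by (simp only: plancherel_L1[OF g])
  also have "(\<integral>\<^sup>+x. ennreal ((cmod (g x))\<^sup>2) \<partial>lborel) = (\<integral>\<^sup>+x. ennreal ((cmod (f x))\<^sup>2) \<partial>lebesgue)"
    unfolding nn_integral_completion using fg by (intro nn_integral_cong_AE) (auto elim: eventually_mono)
  finally show ?thesis .
qed

end
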